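(* Let $q$ be a prime power and let $n$ range over the even positive integers. Let $\widehat{C}^{(n)}_{2k}$ be the random matrices described in the context. Let $(k_n)$ be a sequence of positive integers, and let $t_n=\frac{q^{-n/2}}{q-1}k_n$. (1) If $\lim_{n\to\infty}t_n=0$, then $$\lim_{n\to\infty}\mathbb{P}\left(\widehat{C}^{(n)}_{2k_n}\text{ has a delocalized kernel}\right)=1.$$ (2) If $\limsup_{n\to\infty}t_n\ge\varepsilon>0$, then for each positive integer $L\ge\varepsilon$, $$\limsup_{n\to\infty}\mathbb{P}\left(\widehat{C}^{(n)}_{2k_n}\text{ has an $L$-localized kernel}\right)\ge\left(C\left(\frac{\varepsilon}{L}\right)^2\right)^L$$ for some constant $C>0$ depending only on $q$.
   Context: Let $A=(A_{i,j})_{i,j=1}^\infty$ be a random infinite block matrix over $\mathbb{F}_q$ whose blocks are $n\times n$ matrices, such that $A_{i,j}=0$ whenever $j\notin\{i,i-1\}$, while the blocks $A_{i,i}$ ($i\ge1$) and $A_{i,i-1}$ ($i\ge 2$) are independent and uniformly distributed over all $n\times n$ matrices over $\mathbb{F}_q$. For $k\ge 1$, $C_{2k}$ is the submatrix of $A$ formed by the first $(k+1)n$ rows and first $kn$ columns. $\widehat{C}_{2k}=\widehat{C}_{2k}^{(n)}$ is the $(k+1)n\times(k+1)n$ matrix obtained from $C_{2(k+1)}$ by deleting the first $n/2$ rows and the last $n/2$ rows. A vector $v\in\mathbb{F}_q^{kn}$ is written uniquely as the concatenation of $v_1,\dots,v_k\in\mathbb{F}_q^n$, and $\operatorname{supp}(v)=\{i\in\{1,\dots,k\}: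 v_i\ne 0\}$. $\widehat{C}_{2k_n}$ has a delocalized kernel if $\operatorname{supp}(v)=\{1,2,\dots,k_n+1\}$ for all $v\in\ker\widehat{C}_{2k_n}\setminus\{0\}$. Given a positive integer $L$, set $\bar{k}_n=\left\lfloor\frac{k_n+1}{L}\right\rfloor$ and for $i=1,\dots,L$ let $V_i=\{v\in\mathbb{F}_q^{(k_n+1)n}:\emptyset\ne\operatorname{supp}(v)\subset[(i-1)\bar{k}_n+1,\,i\bar{k}_n]\}$. $\widehat{C}_{2k_n}$ has an $L$-localized kernel if for all $i=1,2,\dots,L$ there is a $v_i\in V_i$ such that $\widehat{C}_{2k_n}v_i=0$. *)

theory Defs
  imports
    "HOL-Probability.Probability"
    "Jordan_Normal_Form.Matrix_Kernel"
begin

text \<open>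
  Block indices are 1-based, as are block rows, block columns and supports; the entries of
  the type \<open>'a mat\<close> and \<open>'a vec\<close> are indexed from 0.  The field with \<open>q\<close> elements
  is a finite field type \<open>'a\<close>, so \<open>q = CARD('a)\<close>.
\<close>

definition band :: "(nat \<times> nat) set" where
  "band = {(i, j). 1 \<le> i \<and> 1 \<le> j \<and> (j = i \<or> j + 1 = i)}"

text \<open>
  The canonical probability space carrying the infinite random block matrix: the possibly
  nonzero blocks are the coordinates of a product measure.  Nothing is lost by working on this
  space, since the joint law of the blocks is determined by independence and uniformity: see
  \<open>distr_blocks_eq_block_space\<close> below.
\<close>

definition block_space :: "nat \<Rightarrow> (nat \<times> nat \<Rightarrow> 'a::{field,finite} mat) measure" where
  "block_space n = Pi\<^sub>M band (\<lambda>_. uniform_count_measure (carrier_mat n n))"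

definition block :: "nat \<Rightarrow> (nat \<times> nat \<Rightarrow> 'a::{field,finite} mat) \<Rightarrow> nat \<Rightarrow> nat \<Rightarrow> 'a mat" where
  "block n \<omega> i j = (if (i, j) \<in> band then \<omega> (i, j) else 0\<^sub>m n n)"

text \<open>
  \<open>C_mat n \<omega> k\<close> is $C_{2k}$, and \<open>C_hat n \<omega> k\<close> is $\widehat C_{2k}$: the matrix
  $C_{2(k+1)}$, which has $(k+2)n$ rows, without its first and its last $n/2$ rows.
\<close>

definition C_mat :: "nat \<Rightarrow> (nat \<times> nat \<Rightarrow> 'a::{field,finite} mat) \<Rightarrow> nat \<Rightarrow> 'a mat" where
  "C_mat n \<omega> k = mat ((k + 1) * n) (k * n)
     (\<lambda>(r, c). block n \<omega> (r div n + 1) (c div n + 1) $$ (r mod n, c mod n))"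

definition C_hat :: "nat \<Rightarrow> (nat \<times> nat \<Rightarrow> 'a::{field,finite} mat) \<Rightarrow> nat \<Rightarrow> 'a mat" where
  "C_hat n \<omega> k = mat ((k + 1) * n) ((k + 1) * n)
     (\<lambda>(r, c). C_mat n \<omega> (k + 1) $$ (r + n div 2, c))"

definition vec_block :: "nat \<Rightarrow> 'a vec \<Rightarrow> nat \<Rightarrow> 'a vec" where
  "vec_block n v i = vec n (\<lambda>r. v $ ((i - 1) * n + r))"

definition supp :: "nat \<Rightarrow> nat \<Rightarrow> 'a::zero vec \<Rightarrow> nat set" where
  "supp n k v = {i \<in> {1..k}. vec_block n v i \<noteq> 0\<^sub>v n}"

definition delocalized_kernel ::
  "nat \<Rightarrow> nat \<Rightarrow> (nat \<times> nat \<Rightarrow> 'a::{field,finite} mat) \<Rightarrow> bool" where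
  "delocalized_kernel n k \<omega> \<longleftrightarrow>
     (\<forall>v \<in> mat_kernel (C_hat n \<omega> k) - {0\<^sub>v ((k + 1) * n)}. supp n (k + 1) v = {1..k + 1})"

definition V_set :: "nat \<Rightarrow> nat \<Rightarrow> nat \<Rightarrow> nat \<Rightarrow> 'a::zero vec set" where
  "V_set n k L i = {v \<in> carrier_vec ((k + 1) * n).
     supp n (k + 1) v \<noteq> {} \<and>
     supp n (k + 1) v \<subseteq> {(i - 1) * ((k + 1) div L) + 1 .. i * ((k + 1) div L)}}"

definition localized_kernel ::
  "nat \<Rightarrow> nat \<Rightarrow> nat \<Rightarrow> (nat \<times> nat \<Rightarrow> 'a::{field,finite} mat) \<Rightarrow> bool" where
  "localized_kernel n k L \<omega> \<longleftrightarrow>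
     (\<forall>i \<in> {1..L}. \<exists>v \<in> V_set n k L i. C_hat n \<omega> k *\<^sub>v v = 0\<^sub>v ((k + 1) * n))"

definition even_at_top :: "nat filter" where
  "even_at_top = inf at_top (principal {n. even n})"

definition t_seq :: "nat \<Rightarrow> (nat \<Rightarrow> nat) \<Rightarrow> nat \<Rightarrow> real" where
  "t_seq q k n = real q powr (- (real n / 2)) / (real q - 1) * real (k n)"

lemma finite_carrier_mat: "finite (carrier_mat n m :: 'a::finite mat set)"
proof -
  have "carrier_mat n m \<subseteq> (\<lambda>f. mat n m f) ` (({0..<n} \<times> {0..<m}) \<rightarrow>\<^sub>E (UNIV :: 'a set))"
  proof
    fix A :: "'a mat" assume A: "A \<in> carrier_mat n m"
    have "A = mat n m (restrict (\<lambda>ij. A $$ ij) ({0..<n} \<times> {0..<m}))"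
      using A by (intro eq_matI) auto
    then show "A \<in> (\<lambda>f. mat n m f) ` (({0..<n} \<times> {0..<m}) \<rightarrow>\<^sub>E (UNIV :: 'a set))"
      by (intro image_eqI[of A "mat n m" "restrict (\<lambda>ij. A $$ ij) ({0..<n} \<times> {0..<m})"]) auto
  qed
  then show ?thesis
    by (rule finite_subset) (intro finite_imageI finite_PiE, auto)
qed

lemma prob_space_uniform_mat:
  "prob_space (uniform_count_measure (carrier_mat n m :: 'a::{field,finite} mat set))"
  by (rule prob_space_uniform_count_measure) (auto simp: finite_carrier_mat intro: zero_carrier_mat)

lemma prob_space_block_space:
  "prob_space (block_space n :: (nat \<times> nat \<Rightarrow> 'a::{field,finite} mat) measure)"
  unfolding block_space_def by (rule prob_space_PiM) (rule prob_space_uniform_mat)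

text \<open>Any family of independent uniform blocks, on any probability space, has the law above.\<close>

lemma distr_blocks_eq_block_space:
  fixes M :: "'w measure" and X :: "nat \<times> nat \<Rightarrow> 'w \<Rightarrow> 'a::{field,finite} mat"
  assumes "prob_space M"
    and indep: "prob_space.indep_vars M (\<lambda>_. uniform_count_measure (carrier_mat n n)) X band"
    and unif: "\<And>b. b \<in> band \<Longrightarrow>
      distr M (uniform_count_measure (carrier_mat n n)) (X b) = uniform_count_measure (carrier_mat n n)"
  shows "distr M (block_space n) (\<lambda>w. \<lambda>b\<in>band. X b w) = block_space n"
proof -
  interpret prob_space M by fact
  have ne: "band \<noteq> {}" by (auto simp: band_def)
  have rv: "random_variable (uniform_count_measure (carrier_mat n n)) (X b)" if "b \<in> band" for b
    using indep that by (auto simp: indep_vars_def)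
  show ?thesis
    unfolding block_space_def
    using indep_vars_iff_distr_eq_PiM'[OF ne rv] indep unif by (simp cong: PiM_cong)
qed

text \<open>
  The two events depend on finitely many blocks, hence are measurable; so their
  \<open>measure\<close> is a genuine probability.
\<close>

lemma C_hat_cong:
  assumes "\<And>b. b \<in> band \<inter> {1..k + 2} \<times> {1..k + 1} \<Longrightarrow> \<omega> b = \<omega>' b"
  shows "C_hat n \<omega> k = C_hat n \<omega>' k"
proof (cases "n = 0")
  case True
  then show ?thesis by (intro eq_matI) (simp_all add: C_hat_def)
next
  case False
  have *: "block n \<omega> (r div n + 1) (c div n + 1) = block n \<omega>' (r div n + 1) (c div n + 1)"
    if "r < (k + 2) * n" "c < (k + 1) * n" for r c
  proof -
    have "r div n < k + 2" "c div n < k + 1"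
      using that False by (simp_all only: div_less_iff_less_mult)
    then show ?thesis
      using assms[of "(r div n + 1, c div n + 1)"] by (auto simp: block_def)
  qed
  have "C_mat n \<omega> (k + 1) = C_mat n \<omega>' (k + 1)"
    unfolding C_mat_def by (rule eq_matI) (use * in \<open>simp_all add: algebra_simps\<close>)
  then show ?thesis by (simp add: C_hat_def)
qed

lemma sets_block_space_C_hat:
  "{\<omega> \<in> space (block_space n :: (nat \<times> nat \<Rightarrow> 'a::{field,finite} mat) measure). P (C_hat n \<omega> k)}
     \<in> sets (block_space n)"
proof -
  define J where "J = band \<inter> {1..k + 2} \<times> {1..k + 1}"
  define U where "U = uniform_count_measure (carrier_mat n n :: 'a mat set)"
  define B where "B = (block_space n :: (nat \<times> nat \<Rightarrow> 'a mat) measure)"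
  define G where "G = {g \<in> J \<rightarrow>\<^sub>E (carrier_mat n n :: 'a mat set). P (C_hat n g k)}"
  have B_eq: "B = Pi\<^sub>M band (\<lambda>_. U)" by (simp only: B_def U_def block_space_def)
  have spU: "space U = carrier_mat n n" by (simp add: U_def space_uniform_count_measure)
  have fin: "finite J" unfolding J_def by (rule finite_Int) simp
  have "(1, 1) \<in> J" by (simp add: J_def band_def)
  then have ne: "J \<noteq> {}" by blast
  have sub: "J \<subseteq> band" unfolding J_def by (rule Int_lower1)
  have "finite (J \<rightarrow>\<^sub>E (carrier_mat n n :: 'a mat set))"
    by (rule finite_PiE[OF fin]) (rule finite_carrier_mat)
  then have finG: "finite G" unfolding G_def by (rule rev_finite_subset) blast
  have comp: "(\<lambda>\<omega>. \<omega> b) \<in> measurable B U" if "b \<in> J" for b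
    unfolding B_eq by (rule measurable_component_singleton) (use that sub in blast)
  have meas: "{\<omega> \<in> space B. \<forall>b\<in>J. \<omega> b = g b} \<in> sets B" if g: "g \<in> G" for g
  proof (rule sets.sets_Collect_finite_All'[OF _ fin ne])
    fix b assume b: "b \<in> J"
    have "g b \<in> carrier_mat n n" using g b unfolding G_def by (blast dest: PiE_mem)
    then have "{g b} \<in> sets U" unfolding U_def by (simp add: sets_uniform_count_measure)
    from measurable_sets[OF comp[OF b] this]
    show "{\<omega> \<in> space B. \<omega> b = g b} \<in> sets B"
      by (simp add: vimage_def Int_def conj_commute)
  qed
  have cong: "C_hat n \<omega> k = C_hat n \<omega>' k" if "\<And>b. b \<in> J \<Longrightarrow> \<omega> b = \<omega>' b"
    for \<omega> \<omega>' :: "nat \<times> nat \<Rightarrow> 'a mat"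
    by (rule C_hat_cong) (rule that, simp only: J_def)
  have "{\<omega> \<in> space B. P (C_hat n \<omega> k)} = (\<Union>g\<in>G. {\<omega> \<in> space B. \<forall>b\<in>J. \<omega> b = g b})"
  proof (intro equalityI subsetI)
    fix \<omega> assume w: "\<omega> \<in> {\<omega> \<in> space B. P (C_hat n \<omega> k)}"
    have "C_hat n (restrict \<omega> J) k = C_hat n \<omega> k"
      by (rule cong) simp
    moreover have "\<omega> b \<in> carrier_mat n n" if "b \<in> J" for b
      using measurable_space[OF comp[OF that], of \<omega>] w unfolding spU by blast
    ultimately have "restrict \<omega> J \<in> G"
      using w unfolding G_def by simp
    then show "\<omega> \<in> (\<Union>g\<in>G. {\<omega> \<in> space B. \<forall>b\<in>J. \<omega> b = g b})"
      by (rule UN_I) (use w in simp)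
  next
    fix \<omega> assume "\<omega> \<in> (\<Union>g\<in>G. {\<omega> \<in> space B. \<forall>b\<in>J. \<omega> b = g b})"
    then obtain g where g: "P (C_hat n g k)" "\<omega> \<in> space B" "\<forall>b\<in>J. \<omega> b = g b"
      unfolding G_def by blast
    have "C_hat n \<omega> k = C_hat n g k" by (rule cong) (use g(3) in blast)
    with g show "\<omega> \<in> {\<omega> \<in> space B. P (C_hat n \<omega> k)}" by simp
  qed
  also have "\<dots> \<in> sets B" by (rule sets.finite_UN[OF finG meas])
  finally show ?thesis unfolding B_def .
qed

lemma sets_delocalized_kernel:
  "{\<omega> \<in> space (block_space n). delocalized_kernel n k \<omega>} \<in> sets (block_space n)"
  unfolding delocalized_kernel_def by (rule sets_block_space_C_hat)

lemma sets_localized_kernel: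
  "{\<omega> \<in> space (block_space n). localized_kernel n k L \<omega>} \<in> sets (block_space n)"
  unfolding localized_kernel_def by (rule sets_block_space_C_hat)

end

theory Submission
  imports Defs
begin

text \<open>
  Write \<open>x = q\<^sup>-\<^sup>n\<close>. For a fixed block vector \<open>V\<close> the equations of different scalar rows of
  $\widehat C_{2k}$ involve disjoint sets of entries, so they are independent, and an equation holds with
  probability \<open>1/q\<close> or \<open>1\<close> according to whether the part of \<open>V\<close> that it sees is nonzero or zero. A vector
  whose support is an interval of \<open>l\<close> block indices meets \<open>l + 1\<close> block rows, so it lies in the kernel with
  probability \<open>x\<^sup>l\<^sup>+\<^sup>1\<close>, where each of the two halved block rows that it meets saves a factor \<open>q\<^sup>n\<^sup>/\<^sup>2\<close>. As there are about
  \<open>x\<^sup>-\<^sup>l\<close> such vectors, the expected number of kernel vectors on an interval is about \<open>x\<close> in the interior,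
  \<open>x\<^sup>1\<^sup>/\<^sup>2\<close> for a proper interval at one of the two ends, and \<open>1\<close> only for the full interval.
  
  Delocalization. Cutting a kernel vector down to one run of consecutive nonzero blocks gives a kernel
  vector again (\<open>exists_proper_run\<close>), so a kernel that is not delocalized contains a vector supported
  on a proper interval. By the union bound (\<open>pr_proper_run_kernel_le\<close>) this has probability at most
  \<open>y\<^sup>2 + 2 y\<close> with \<open>y = (k\<^sub>n + 1) q\<^sup>-\<^sup>n\<^sup>/\<^sup>2 \<le> 2 (q - 1) t\<^sub>n\<close>, which tends to \<open>0\<close> with \<open>t\<^sub>n\<close>.
  
  Localization. Take in each of the \<open>L\<close> windows a subwindow of \<open>K\<close> block columns with \<open>K \<approx> q\<^sup>n\<^sup>/\<^sup>2 \<epsilon> / (3 q L)\<close>.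
  Subwindows use disjoint sets of block columns, so the events that they carry a kernel vector are
  independent, and it suffices to show that each has probability of order \<open>K\<^sup>2 x\<close>, that is of order
  \<open>(\<epsilon> / L)\<^sup>2\<close> (\<open>pr_window_kernel_ge\<close>). The number of kernel vectors of a subwindow that are supported on an interval
  has expectation of order \<open>K\<^sup>2 x\<close>. By the second moment method (\<open>prob_Ex_ge_second_moment\<close>) the
  probability that one exists has the same order if, given one of them, the expected number of all kernel vectors stays
  bounded. That conditional expectation is a sum over paths, which a transfer recursion
  evaluates; \<open>transfer_mass_bound\<close> bounds it by \<open>2 q\<close> as long as \<open>6 q\<^sup>2 K\<^sup>2 x \<le> 1\<close>. This is where the
  subwindows must not be longer than a small multiple of \<open>q\<^sup>n\<^sup>/\<^sup>2\<close>.
\<close>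

section \<open>Linear forms in independent uniform entries\<close>

definition unif_fun :: "'i set \<Rightarrow> ('i \<Rightarrow> 'a::{field,finite}) pmf" where
  "unif_fun S = Pi_pmf S 0 (\<lambda>_. pmf_of_set UNIV)"

abbreviation pr :: "'i set \<Rightarrow> (('i \<Rightarrow> 'a::{field,finite}) \<Rightarrow> bool) \<Rightarrow> real" where
  "pr S Q \<equiv> measure_pmf.prob (unif_fun S) {f. Q f}"

lemma pr_mono: "(\<And>f. P f \<Longrightarrow> Q f) \<Longrightarrow> pr S P \<le> pr S Q"
  by (intro measure_pmf.finite_measure_mono) auto

definition depends_on :: "'i set \<Rightarrow> (('i \<Rightarrow> 'b) \<Rightarrow> bool) \<Rightarrow> bool" where
  "depends_on D Q \<longleftrightarrow> (\<forall>f g. (\<forall>x\<in>D. f x = g x) \<longrightarrow> Q f = Q g)"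

lemma pr_eq_card:
  assumes "finite S"
  shows "pr S (Q :: ('i \<Rightarrow> 'a::{field,finite}) \<Rightarrow> bool) =
    card {f \<in> PiE_dflt S 0 (\<lambda>_. UNIV). Q f} / card (PiE_dflt S 0 (\<lambda>_. UNIV :: 'a set))"
proof -
  have fin: "finite (PiE_dflt S 0 (\<lambda>_. UNIV :: 'a set))" using assms by (intro finite_PiE_dflt) auto
  have ne: "PiE_dflt S 0 (\<lambda>_. UNIV :: 'a set) \<noteq> {}" by simp
  have "unif_fun S = pmf_of_set (PiE_dflt S 0 (\<lambda>_. UNIV :: 'a set))"
    unfolding unif_fun_def using assms by (intro Pi_pmf_of_set) auto
  then show ?thesis
    using measure_pmf_of_set[OF ne fin, of "{f. Q f}"] by (simp add: Int_def)
qed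

lemma pr_independent:
  assumes S: "finite S" and R: "finite R"
    and D: "\<And>r. r \<in> R \<Longrightarrow> D r \<subseteq> S" "disjoint_family_on D R"
    and dep: "\<And>r. r \<in> R \<Longrightarrow> depends_on (D r) (Q r)"
  shows "pr S (\<lambda>f :: 'i \<Rightarrow> 'a::{field,finite}. \<forall>r\<in>R. Q r f) = (\<Prod>r\<in>R. pr S (Q r))"
proof (cases "R = {}")
  case True
  then show ?thesis by simp
next
  case False
  let ?M = "measure_pmf (unif_fun S :: ('i \<Rightarrow> 'a) pmf)"
  have P: "prob_space ?M" by (rule measure_pmf.prob_space_axioms)
  let ?X = "\<lambda>r f. restrict (\<lambda>i. f i) (D r)"
  have ind: "prob_space.indep_vars ?M (\<lambda>r. PiM (D r) (\<lambda>_. count_space UNIV)) ?X R"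
    by (rule prob_space.indep_vars_restrict[OF P _ D]) (use S in \<open>auto simp: unif_fun_def indep_vars_Pi_pmf\<close>)
  have ind': "prob_space.indep_vars ?M (\<lambda>r. count_space UNIV) (\<lambda>r f. Q r (?X r f)) R"
  proof (rule prob_space.indep_vars_compose2[OF P ind])
    fix r assume r: "r \<in> R"
    have finD: "finite (D r)" using D(1)[OF r] S finite_subset by blast
    have "PiM (D r) (\<lambda>_. count_space (UNIV :: 'a set)) = count_space (PiE (D r) (\<lambda>_. UNIV))"
      by (rule count_space_PiM_finite) (use finD in auto)
    then show "Q r \<in> PiM (D r) (\<lambda>_. count_space (UNIV :: 'a set)) \<rightarrow>\<^sub>M count_space UNIV"
      by simp
  qed
  have eq: "Q r (?X r f) = Q r f" if "r \<in> R" for r f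
    using dep[OF that] by (auto simp: depends_on_def)
  have "measure_pmf.prob (unif_fun S) (\<Inter>r\<in>R. (\<lambda>f. Q r (?X r f)) -` {True} \<inter> space ?M)
     = (\<Prod>r\<in>R. measure_pmf.prob (unif_fun S) ((\<lambda>f. Q r (?X r f)) -` {True} \<inter> space ?M))"
    by (rule prob_space.indep_varsD_finite[OF P ind' False R]) auto
  moreover have "(\<Inter>r\<in>R. (\<lambda>f. Q r (?X r f)) -` {True} \<inter> space ?M) = {f. \<forall>r\<in>R. Q r f}"
    using False by (auto simp: eq)
  moreover have "(\<lambda>f. Q r (?X r f)) -` {True} \<inter> space ?M = {f. Q r f}" if "r \<in> R" for r
    using that by (auto simp: eq)
  ultimately show ?thesis by simp
qed

definition lin :: "'i set \<Rightarrow> ('i \<Rightarrow> 'a::comm_ring_1) \<Rightarrow> ('i \<Rightarrow> 'a) \<Rightarrow> 'a" where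
  "lin D u f = (\<Sum>i\<in>D. f i * u i)"

lemma lin_add_scaled: "lin D u (\<lambda>i. f i + c * d i) = lin D u f + c * lin D u d"
  by (simp add: lin_def sum.distrib sum_distrib_left algebra_simps)

text \<open>
  Translation by \<open>c \<cdot> d\<close> maps the solutions of \<open>A\<close> on which the form vanishes onto those on which it
  equals \<open>c\<close>; so the form is uniformly distributed on the solutions of \<open>A\<close>.
\<close>
lemma pr_lin_eq_0_translation:
  fixes u d :: "'i \<Rightarrow> 'a::{field,finite}"
  assumes S: "finite S" and d: "\<And>i. i \<notin> S \<Longrightarrow> d i = 0" "lin D u d = 1"
    and A: "\<And>f c. A (\<lambda>i. f i + c * d i) = A f"
  shows "pr S (\<lambda>f. A f \<and> lin D u f = 0) = pr S A / CARD('a)"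
proof -
  let ?F = "PiE_dflt S 0 (\<lambda>_. UNIV :: 'a set)"
  define B where "B c = {f \<in> ?F. A f \<and> lin D u f = c}" for c
  have fin: "finite ?F" using S by (intro finite_PiE_dflt) auto
  have "bij_betw (\<lambda>f i. f i + c * d i) (B 0) (B c)" for c
  proof (rule bij_betwI[where g = "\<lambda>f i. f i + (- c) * d i"])
    show "(\<lambda>f i. f i + c * d i) \<in> B 0 \<rightarrow> B c"
      using d(1) by (auto simp: B_def A lin_add_scaled d(2) PiE_dflt_def)
    show "(\<lambda>f i. f i + (- c) * d i) \<in> B c \<rightarrow> B 0"
      using d(1) A[of _ "- c"] lin_add_scaled[of D u _ "- c" d] by (auto simp: B_def d(2) PiE_dflt_def)
  qed auto
  then have c: "card (B c) = card (B 0)" for c by (metis bij_betw_same_card)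
  have "{f \<in> ?F. A f} = (\<Union>c. B c)" by (auto simp: B_def)
  also have "card \<dots> = (\<Sum>c\<in>UNIV. card (B c))"
    using fin by (intro card_UN_disjoint) (auto simp: B_def)
  also have "\<dots> = CARD('a) * card (B 0)" by (subst sum.cong[OF refl c]) simp
  finally have "card {f \<in> ?F. A f} = CARD('a) * card (B 0)" .
  then show ?thesis
    unfolding pr_eq_card[OF S] B_def by simp
qed

text \<open>
  If the second coefficient vector is no multiple of the first, some direction is killed by the first
  form and not by the second, and translation along it makes the second form uniform while it
  preserves the first equation.
\<close>
lemma pr_two_lin_eq_0:
  fixes u u' :: "'i \<Rightarrow> 'a::{field,finite}"
  assumes S: "finite S" and D: "D \<subseteq> S"
  shows "pr S (\<lambda>f. lin D u f = 0 \<and> lin D u' f = 0) =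
    pr S (\<lambda>f. lin D u f = 0) * (if \<exists>c. \<forall>i\<in>D. u' i = c * u i then 1 else 1 / CARD('a))"
proof (cases "\<exists>c. \<forall>i\<in>D. u' i = c * u i")
  case True
  then obtain c where c: "\<forall>i\<in>D. u' i = c * u i" by blast
  have "lin D u' f = c * lin D u f" for f
    using c by (auto simp: lin_def sum_distrib_left intro!: sum.cong)
  then have "lin D u f = 0 \<and> lin D u' f = 0 \<longleftrightarrow> lin D u f = 0" for f by auto
  then show ?thesis using True by simp
next
  case False
  have finD: "finite D" using S D finite_subset by blast
  have lin1: "lin D w (\<lambda>i. if i = l then y else 0) = y * w l" if "l \<in> D" for w l y
    using that finD by (simp add: lin_def if_distrib[of "\<lambda>x. x * _"] cong: if_cong)
  have "\<exists>d. (\<forall>i. i \<notin> D \<longrightarrow> d i = 0) \<and> lin D u d = 0 \<and> lin D u' d \<noteq> 0"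
  proof (cases "\<forall>i\<in>D. u i = 0")
    case True
    from False[simplified, rule_format, of 0] obtain l where l: "l \<in> D" "u' l \<noteq> 0" by auto
    show ?thesis
      by (rule exI[of _ "\<lambda>i. if i = l then 1 else 0"]) (use l True in \<open>auto simp: lin1\<close>)
  next
    case u: False
    then obtain j where j: "j \<in> D" "u j \<noteq> 0" by blast
    from False[simplified, rule_format, of "u' j / u j"] obtain l
      where l: "l \<in> D" "u' l \<noteq> u' j / u j * u l" by auto
    define d where "d i = (if i = l then 1 else 0) + (- u l / u j) * (if i = j then 1 else 0)" for i
    have "lin D w d = w l + (- u l / u j) * w j" for w
      unfolding d_def by (subst lin_add_scaled) (use l j in \<open>simp add: lin1\<close>)
    moreover have "u' l + (- u l / u j) * u' j \<noteq> 0" using l j by (simp add: field_simps)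
    moreover have "d i = 0" if "i \<notin> D" for i using that l j by (auto simp: d_def)
    ultimately show ?thesis using j by (intro exI[of _ d]) auto
  qed
  then obtain d where d: "\<And>i. i \<notin> D \<Longrightarrow> d i = 0" "lin D u d = 0" "lin D u' d \<noteq> 0" by blast
  define e where "e = (\<lambda>i. d i / lin D u' d)"
  have e: "lin D w e = lin D w d / lin D u' d" for w
    by (simp add: e_def lin_def sum_divide_distrib)
  have "pr S (\<lambda>f. lin D u f = 0 \<and> lin D u' f = 0) = pr S (\<lambda>f. lin D u f = 0) / CARD('a)"
  proof (rule pr_lin_eq_0_translation[OF S])
    show "e i = 0" if "i \<notin> S" for i using that D d(1) by (auto simp: e_def)
    show "lin D u' e = 1" using d(3) by (simp add: e)
    show "(lin D u (\<lambda>i. f i + c * e i) = 0) = (lin D u f = 0)" for f c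
      using e[of u] d(2) by (simp add: lin_add_scaled)
  qed
  then show ?thesis unfolding if_not_P[OF False] by simp
qed

lemma pr_lin_eq_0:
  fixes u :: "'i \<Rightarrow> 'a::{field,finite}"
  assumes "finite S" "D \<subseteq> S"
  shows "pr S (\<lambda>f. lin D u f = 0) = (if \<forall>i\<in>D. u i = 0 then 1 else 1 / CARD('a))"
proof -
  have "lin D (\<lambda>_. 0) f = 0" for f :: "'i \<Rightarrow> 'a" by (simp add: lin_def)
  then show ?thesis using pr_two_lin_eq_0[OF assms, of "\<lambda>_. 0" u] by simp
qed

section \<open>Equations of the bidiagonal system\<close>

definition smul :: "'a::times \<Rightarrow> (nat \<Rightarrow> 'a) \<Rightarrow> nat \<Rightarrow> 'a" where
  "smul c v = (\<lambda>r. c * v r)"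

abbreviation zero_block :: "nat \<Rightarrow> 'a::zero" where
  "zero_block \<equiv> \<lambda>_. 0"

text \<open>
  Block vectors are functions that vanish outside their index range, so that the block before the
  first and the block after the last one are zero and boundary rows need no separate treatment.
\<close>
definition blocks :: "nat \<Rightarrow> (nat \<Rightarrow> 'a::{field,finite}) set" where
  "blocks n = PiE_dflt {..<n} 0 (\<lambda>_. UNIV)"

definition block_vecs :: "nat set \<Rightarrow> nat \<Rightarrow> (nat \<Rightarrow> nat \<Rightarrow> 'a::{field,finite}) set" where
  "block_vecs W n = PiE_dflt W zero_block (\<lambda>_. blocks n)"

text \<open>
  A position \<open>((i, j), (r, c))\<close> is entry \<open>(r, c)\<close> of block \<open>(i, j)\<close>. The set collects the positions on
  scalar row \<open>r\<close> of block row \<open>i\<close> that can be nonzero, within the block columns \<open>W\<close>.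
\<close>
definition row_pos :: "nat set \<Rightarrow> nat \<Rightarrow> nat \<Rightarrow> nat \<Rightarrow> ((nat \<times> nat) \<times> nat \<times> nat) set" where
  "row_pos W n i r = ({i} \<times> {j \<in> W. j = i \<or> Suc j = i}) \<times> ({r} \<times> {..<n})"

definition solves_row where
  "solves_row W n f V i r \<longleftrightarrow> lin (row_pos W n i r) (\<lambda>p. V (snd (fst p)) (snd (snd p))) f = 0"

definition active :: "(nat \<Rightarrow> nat \<Rightarrow> 'a::zero) \<Rightarrow> nat \<Rightarrow> bool" where
  "active V i \<longleftrightarrow> (\<exists>j. (j = i \<or> Suc j = i) \<and> V j \<noteq> zero_block)"

definition parallel :: "(nat \<Rightarrow> nat \<Rightarrow> 'a::{zero,times}) \<Rightarrow> (nat \<Rightarrow> nat \<Rightarrow> 'a) \<Rightarrow> nat \<Rightarrow> bool" where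
  "parallel V V' i \<longleftrightarrow> (\<exists>c. \<forall>j. (j = i \<or> Suc j = i) \<longrightarrow> V' j = smul c (V j))"

lemma finite_blocks [simp]: "finite (blocks n :: (nat \<Rightarrow> 'a::{field,finite}) set)"
  unfolding blocks_def by (rule finite_PiE_dflt) auto

lemma card_blocks: "card (blocks n :: (nat \<Rightarrow> 'a::{field,finite}) set) = CARD('a) ^ n"
  unfolding blocks_def by (subst card_PiE_dflt) auto

lemma zero_block_in_blocks [simp]: "zero_block \<in> blocks n"
  by (auto simp: blocks_def PiE_dflt_def)

lemma block_vecs_outside: "V \<in> block_vecs W n \<Longrightarrow> j \<notin> W \<Longrightarrow> V j = zero_block"
  by (auto simp: block_vecs_def PiE_dflt_def)

lemma block_vecs_block: "V \<in> block_vecs W n \<Longrightarrow> V j \<in> blocks n"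
  by (cases "j \<in> W") (auto simp: block_vecs_def PiE_dflt_def)

lemma block_vecs_entry: "V \<in> block_vecs W n \<Longrightarrow> c \<ge> n \<Longrightarrow> V j c = 0"
  using block_vecs_block[of V W n j] by (auto simp: blocks_def PiE_dflt_def)

lemma finite_block_vecs: "finite W \<Longrightarrow> finite (block_vecs W n :: (nat \<Rightarrow> nat \<Rightarrow> 'a::{field,finite}) set)"
  unfolding block_vecs_def by (rule finite_PiE_dflt) auto

lemma ball_row_pos_iff:
  "(\<forall>p\<in>row_pos W n i r. P (snd (fst p)) (snd (snd p))) \<longleftrightarrow>
    (\<forall>j. j = i \<or> Suc j = i \<longrightarrow> j \<in> W \<longrightarrow> (\<forall>c<n. P j c))"
  by (auto simp: row_pos_def)

lemma block_eq_zero_iff: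
  assumes "V \<in> block_vecs W n"
  shows "V j = zero_block \<longleftrightarrow> (j \<in> W \<longrightarrow> (\<forall>c<n. V j c = 0))"
proof
  assume *: "j \<in> W \<longrightarrow> (\<forall>c<n. V j c = 0)"
  show "V j = zero_block"
  proof
    fix c show "V j c = 0"
      using * block_vecs_outside[OF assms, of j] block_vecs_entry[OF assms, of c j]
      by (cases "j \<in> W"; cases "c < n") auto
  qed
qed simp

lemma block_eq_smul_iff:
  assumes V: "V \<in> block_vecs W n" "V' \<in> block_vecs W n"
  shows "V' j = smul a (V j) \<longleftrightarrow> (j \<in> W \<longrightarrow> (\<forall>c<n. V' j c = a * V j c))"
proof
  assume *: "j \<in> W \<longrightarrow> (\<forall>c<n. V' j c = a * V j c)"
  show "V' j = smul a (V j)"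
  proof
    fix r
    show "V' j r = smul a (V j) r"
      using * block_vecs_entry[OF V(1), of r j] block_vecs_entry[OF V(2), of r j]
        block_vecs_outside[OF V(1), of j] block_vecs_outside[OF V(2), of j]
      by (cases "j \<in> W"; cases "r < n") (auto simp: smul_def)
  qed
qed (simp add: smul_def)

lemma row_coeffs_zero_iff:
  assumes "V \<in> block_vecs W n"
  shows "(\<forall>p\<in>row_pos W n i r. V (snd (fst p)) (snd (snd p)) = 0) \<longleftrightarrow> \<not> active V i"
  using ball_row_pos_iff[of W n i r "\<lambda>j c. V j c = 0"]
  unfolding active_def block_eq_zero_iff[OF assms] by blast

lemma row_coeffs_multiple_iff:
  assumes V: "V \<in> block_vecs W n" "V' \<in> block_vecs W n"
  shows "(\<exists>a. \<forall>p\<in>row_pos W n i r. V' (snd (fst p)) (snd (snd p)) = a * V (snd (fst p)) (snd (snd p)))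
    \<longleftrightarrow> parallel V V' i"
  unfolding parallel_def block_eq_smul_iff[OF V]
  using ball_row_pos_iff[of W n i r "\<lambda>j c. V' j c = _ * V j c"] by simp

lemma disjoint_family_row_pos: "disjoint_family_on (\<lambda>\<rho>. row_pos W n (fst \<rho>) (snd \<rho>)) R"
  by (auto simp: disjoint_family_on_def row_pos_def)

lemma depends_on_solves_row: "depends_on (row_pos W n i r) (\<lambda>f. solves_row W n f V i r)"
  by (auto simp: depends_on_def solves_row_def lin_def)

lemma pr_solves_rows:
  assumes "finite S" "finite R" and "\<And>i r. (i, r) \<in> R \<Longrightarrow> row_pos W n i r \<subseteq> S"
    and V: "V \<in> block_vecs W n"
  shows "pr S (\<lambda>f :: _ \<Rightarrow> 'a::{field,finite}. \<forall>(i, r)\<in>R. solves_row W n f V i r) =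
    (\<Prod>(i, r)\<in>R. if active V i then 1 / CARD('a) else 1)"
proof -
  have "pr S (\<lambda>f :: _ \<Rightarrow> 'a. \<forall>\<rho>\<in>R. solves_row W n f V (fst \<rho>) (snd \<rho>)) =
    (\<Prod>\<rho>\<in>R. pr S (\<lambda>f. solves_row W n f V (fst \<rho>) (snd \<rho>)))"
    by (rule pr_independent[where D = "\<lambda>\<rho>. row_pos W n (fst \<rho>) (snd \<rho>)"])
      (use assms in \<open>auto simp: depends_on_solves_row disjoint_family_row_pos\<close>)
  also have "\<dots> = (\<Prod>\<rho>\<in>R. if active V (fst \<rho>) then 1 / CARD('a) else 1)"
  proof (rule prod.cong[OF refl])
    fix \<rho> assume "\<rho> \<in> R"
    then have sub: "row_pos W n (fst \<rho>) (snd \<rho>) \<subseteq> S" using assms(3)[of "fst \<rho>" "snd \<rho>"] by simp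
    show "pr S (\<lambda>f. solves_row W n f V (fst \<rho>) (snd \<rho>)) = (if active V (fst \<rho>) then 1 / CARD('a) else 1)"
      unfolding solves_row_def pr_lin_eq_0[OF assms(1) sub] row_coeffs_zero_iff[OF V] by simp
  qed
  finally show ?thesis by (simp add: case_prod_beta)
qed

lemma pr_solves_rows_two:
  assumes "finite S" "finite R" and "\<And>i r. (i, r) \<in> R \<Longrightarrow> row_pos W n i r \<subseteq> S"
    and V: "V \<in> block_vecs W n" "V' \<in> block_vecs W n"
  shows "pr S (\<lambda>f :: _ \<Rightarrow> 'a::{field,finite}.
      (\<forall>(i, r)\<in>R. solves_row W n f V i r) \<and> (\<forall>(i, r)\<in>R. solves_row W n f V' i r)) =
    pr S (\<lambda>f :: _ \<Rightarrow> 'a. \<forall>(i, r)\<in>R. solves_row W n f V i r) *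
    (\<Prod>(i, r)\<in>R. if parallel V V' i then 1 else 1 / CARD('a))"
proof -
  let ?Q = "\<lambda>f \<rho>. solves_row W n f V (fst \<rho>) (snd \<rho>)"
  let ?Q' = "\<lambda>f \<rho>. solves_row W n f V' (fst \<rho>) (snd \<rho>)"
  have Q: "pr S (\<lambda>f :: _ \<Rightarrow> 'a. \<forall>\<rho>\<in>R. ?Q f \<rho>) = (\<Prod>\<rho>\<in>R. pr S (\<lambda>f. ?Q f \<rho>))"
    by (rule pr_independent[where D = "\<lambda>\<rho>. row_pos W n (fst \<rho>) (snd \<rho>)"])
      (use assms in \<open>auto simp: depends_on_solves_row disjoint_family_row_pos\<close>)
  have dep: "depends_on (row_pos W n i r) (\<lambda>f. solves_row W n f V i r \<and> solves_row W n f V' i r)" for i r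
    using depends_on_solves_row[of W n i r V] depends_on_solves_row[of W n i r V']
    unfolding depends_on_def by blast
  have "pr S (\<lambda>f :: _ \<Rightarrow> 'a. \<forall>\<rho>\<in>R. ?Q f \<rho> \<and> ?Q' f \<rho>) = (\<Prod>\<rho>\<in>R. pr S (\<lambda>f. ?Q f \<rho> \<and> ?Q' f \<rho>))"
    by (rule pr_independent[where D = "\<lambda>\<rho>. row_pos W n (fst \<rho>) (snd \<rho>)"])
      (use assms in \<open>auto simp: dep disjoint_family_row_pos\<close>)
  also have "\<dots> = (\<Prod>\<rho>\<in>R. pr S (\<lambda>f. ?Q f \<rho>) * (if parallel V V' (fst \<rho>) then 1 else 1 / CARD('a)))"
  proof (rule prod.cong[OF refl])
    fix \<rho> assume "\<rho> \<in> R"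
    then have sub: "row_pos W n (fst \<rho>) (snd \<rho>) \<subseteq> S" using assms(3)[of "fst \<rho>" "snd \<rho>"] by simp
    show "pr S (\<lambda>f. ?Q f \<rho> \<and> ?Q' f \<rho>)
      = pr S (\<lambda>f. ?Q f \<rho>) * (if parallel V V' (fst \<rho>) then 1 else 1 / CARD('a))"
      unfolding solves_row_def pr_two_lin_eq_0[OF assms(1) sub] row_coeffs_multiple_iff[OF V] by simp
  qed
  finally show ?thesis by (simp add: case_prod_beta ball_conj_distrib prod.distrib Q)
qed

section \<open>Second moment method\<close>

text \<open>
  With \<open>X\<close> the number of events that occur, \<open>1 - (1 - X/C)\<^sup>2\<close> is at most the indicator of \<open>X > 0\<close>. Its
  expectation only involves the first two moments, and the hypothesis bounds the second moment by \<open>C\<close> times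
  the first.
\<close>
lemma prob_Ex_ge_second_moment:
  fixes p :: "'b pmf" and A :: "'v \<Rightarrow> 'b \<Rightarrow> bool"
  assumes fin: "finite I" and C: "C > 0"
    and pair: "\<And>v. v \<in> I \<Longrightarrow> (\<Sum>w\<in>I. measure_pmf.prob p {f. A v f \<and> A w f})
      \<le> C * measure_pmf.prob p {f. A v f}"
  shows "measure_pmf.prob p {f. \<exists>v\<in>I. A v f} \<ge> (\<Sum>v\<in>I. measure_pmf.prob p {f. A v f}) / C"
proof -
  let ?P = "\<lambda>Q. measure_pmf.prob p {f. Q f}"
  let ?E = "measure_pmf.expectation p"
  let ?ind = "\<lambda>Q f. indicator {f. Q f} f :: real"
  let ?X = "\<lambda>f. \<Sum>v\<in>I. ?ind (A v) f"
  define m where "m = (\<Sum>v\<in>I. ?P (A v))"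
  have int: "integrable (measure_pmf p) (?ind Q)" for Q
    by (rule integrable_real_indicator) (auto simp: measure_pmf.emeasure_eq_measure)
  have E: "?E (?ind Q) = ?P Q" for Q by simp
  have intX: "integrable (measure_pmf p) (\<lambda>f. 2 / C * ?X f)"
    by (intro integrable_mult_right Bochner_Integration.integrable_sum int)
  have intXX: "integrable (measure_pmf p) (\<lambda>f. 1 / C\<^sup>2 * (\<Sum>v\<in>I. \<Sum>w\<in>I. ?ind (\<lambda>f. A v f \<and> A w f) f))"
    by (intro integrable_mult_right Bochner_Integration.integrable_sum int)
  have XX: "(\<Sum>v\<in>I. \<Sum>w\<in>I. ?ind (\<lambda>f. A v f \<and> A w f) f) = (?X f)\<^sup>2" for f
    unfolding power2_eq_square sum_product by (intro sum.cong refl) (auto simp: indicator_def)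
  have "m / C = 2 / C * m - 1 / C\<^sup>2 * (C * m)"
    using C by (simp add: power2_eq_square field_simps)
  also have "\<dots> \<le> 2 / C * m - 1 / C\<^sup>2 * (\<Sum>v\<in>I. \<Sum>w\<in>I. ?P (\<lambda>f. A v f \<and> A w f))"
  proof -
    have "(\<Sum>v\<in>I. \<Sum>w\<in>I. ?P (\<lambda>f. A v f \<and> A w f)) \<le> C * m"
      unfolding m_def sum_distrib_left by (intro sum_mono pair)
    then show ?thesis by (intro diff_left_mono mult_left_mono) auto
  qed
  also have "\<dots> = ?E (\<lambda>f. 2 / C * ?X f - 1 / C\<^sup>2 * (\<Sum>v\<in>I. \<Sum>w\<in>I. ?ind (\<lambda>f. A v f \<and> A w f) f))"
    unfolding m_def Bochner_Integration.integral_diff[OF intX intXX]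
    by (simp add: Bochner_Integration.integral_sum int E)
  also have "\<dots> \<le> ?E (?ind (\<lambda>f. \<exists>v\<in>I. A v f))"
  proof (intro integral_mono Bochner_Integration.integrable_diff intX intXX int)
    fix f
    let ?x = "?X f"
    have "2 / C * ?x - 1 / C\<^sup>2 * ?x\<^sup>2 = 1 - (1 - ?x / C)\<^sup>2"
      using C by (simp add: power2_eq_square field_simps)
    also have "\<dots> \<le> 1" by simp
    finally have "2 / C * ?x - 1 / C\<^sup>2 * ?x\<^sup>2 \<le> 1" .
    moreover have "?x = 0" if "\<not> (\<exists>v\<in>I. A v f)" using that by (auto simp: indicator_def)
    ultimately show "2 / C * ?x - 1 / C\<^sup>2 * (\<Sum>v\<in>I. \<Sum>w\<in>I. ?ind (\<lambda>f. A v f \<and> A w f) f)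
        \<le> ?ind (\<lambda>f. \<exists>v\<in>I. A v f) f"
      unfolding XX by (cases "\<exists>v\<in>I. A v f") auto
  qed
  also have "\<dots> = ?P (\<lambda>f. \<exists>v\<in>I. A v f)" by (rule E)
  finally show ?thesis unfolding m_def .
qed

section \<open>Conditional expectation of the number of solutions\<close>

text \<open>
  Let \<open>V\<close> solve the system. Given this, block row \<open>i + 1\<close> also annihilates a vector with blocks \<open>y'\<close> and \<open>y\<close> at
  \<open>i\<close> and \<open>i + 1\<close> with probability \<open>1\<close> if \<open>(y', y)\<close> is a multiple of \<open>(V i, V (i + 1))\<close>, and \<open>x = q\<^sup>-\<^sup>n\<close>
  otherwise.
\<close>
definition step_weight :: "real \<Rightarrow> (nat \<Rightarrow> nat \<Rightarrow> 'a::{field,finite}) \<Rightarrow> nat \<Rightarrow> (nat \<Rightarrow> 'a) \<Rightarrow> (nat \<Rightarrow> 'a) \<Rightarrow> real" where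
  "step_weight x V i y' y = (if \<exists>c. y' = smul c (V i) \<and> y = smul c (V (Suc i)) then 1 else x)"

text \<open>
  The total weight of all sequences of blocks that start with a zero block at position \<open>a\<close> and reach \<open>y\<close> after \<open>i\<close> steps.
\<close>
fun path_weight :: "real \<Rightarrow> nat \<Rightarrow> nat \<Rightarrow> (nat \<Rightarrow> nat \<Rightarrow> 'a::{field,finite}) \<Rightarrow> nat \<Rightarrow> (nat \<Rightarrow> 'a) \<Rightarrow> real" where
  "path_weight x n a V 0 y = (if y = zero_block then 1 else 0)"
| "path_weight x n a V (Suc i) y =
    (\<Sum>y'\<in>blocks n. path_weight x n a V i y' * step_weight x V (a + i) y' y)"

lemma path_weight_nonneg: "x \<ge> 0 \<Longrightarrow> path_weight x n a V i y \<ge> 0"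
  by (induction i arbitrary: y) (auto simp: step_weight_def intro!: sum_nonneg mult_nonneg_nonneg)

lemma sum_block_vecs_insert:
  fixes h :: "(nat \<Rightarrow> nat \<Rightarrow> 'a::{field,finite}) \<Rightarrow> real"
  assumes "k \<notin> W"
  shows "(\<Sum>w\<in>block_vecs (insert k W) n. h w) = (\<Sum>y\<in>blocks n. \<Sum>w\<in>block_vecs W n. h (w(k := y)))"
proof -
  have "(\<Sum>y\<in>blocks n. \<Sum>w\<in>block_vecs W n. h (w(k := y)))
    = (\<Sum>p\<in>blocks n \<times> block_vecs W n. h ((snd p)(k := fst p)))"
    by (simp add: sum.cartesian_product case_prod_beta)
  also have "\<dots> = (\<Sum>w\<in>block_vecs (insert k W) n. h w)"
  proof (rule sum.reindex_bij_witness[where i = "\<lambda>w. (w k, w(k := zero_block))"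
        and j = "\<lambda>p. (snd p)(k := fst p)"])
    fix p assume p: "p \<in> (blocks n :: (nat \<Rightarrow> 'a) set) \<times> (block_vecs W n :: (nat \<Rightarrow> nat \<Rightarrow> 'a) set)"
    then have "snd p k = zero_block" using block_vecs_outside assms by (metis mem_Times_iff)
    then show "(((snd p)(k := fst p)) k, ((snd p)(k := fst p))(k := zero_block)) = p"
      by (metis fun_upd_same fun_upd_triv fun_upd_upd prod.collapse)
    show "(snd p)(k := fst p) \<in> block_vecs (insert k W) n"
      using p by (auto simp: block_vecs_def PiE_dflt_def)
  next
    fix w assume "w \<in> (block_vecs (insert k W) n :: (nat \<Rightarrow> nat \<Rightarrow> 'a) set)"
    then show "(w k, w(k := zero_block)) \<in> blocks n \<times> block_vecs W n"
      using assms by (auto simp: block_vecs_def PiE_dflt_def)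
  qed auto
  finally show ?thesis ..
qed

lemma block_vecs_empty: "block_vecs {} n = {\<lambda>_. zero_block}"
  by (auto simp: block_vecs_def PiE_dflt_def)

text \<open>
  Summing out the blocks one after the other turns the sum over all vectors into the recursion.
\<close>
lemma sum_block_vecs_eq_path_weight:
  fixes V :: "nat \<Rightarrow> nat \<Rightarrow> 'a::{field,finite}"
  shows "(\<Sum>w\<in>block_vecs {a<..a + i} n.
      (\<Prod>j\<in>{a..<a + i}. step_weight x V j (w j) (w (Suc j))) * step_weight x V (a + i) (w (a + i)) y)
    = path_weight x n a V (Suc i) y"
proof (induction i arbitrary: y)
  case 0
  have "(\<Sum>y'\<in>blocks n. (if y' = zero_block then 1 else 0) * step_weight x V a y' y)
    = step_weight x V a zero_block y"
    by (simp add: if_distrib[of "\<lambda>t. t * _"] cong: if_cong)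
  then show ?case by (simp add: block_vecs_empty)
next
  case (Suc i)
  let ?g = "step_weight x V"
  have ins: "{a<..a + Suc i} = insert (Suc (a + i)) {a<..a + i}" by auto
  have ins': "{a..<a + Suc i} = insert (a + i) {a..<a + i}" by auto
  have "(\<Sum>w\<in>block_vecs {a<..a + Suc i} n.
      (\<Prod>j\<in>{a..<a + Suc i}. ?g j (w j) (w (Suc j))) * ?g (a + Suc i) (w (a + Suc i)) y)
    = (\<Sum>y'\<in>blocks n. \<Sum>w\<in>block_vecs {a<..a + i} n.
      (\<Prod>j\<in>{a..<a + i}. ?g j (w j) (w (Suc j))) * ?g (a + i) (w (a + i)) y' * ?g (a + Suc i) y' y)"
    unfolding ins
  proof (subst sum_block_vecs_insert, simp, intro sum.cong refl)
    fix y' w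
    have "(\<Prod>j\<in>{a..<a + i}. ?g j ((w(Suc (a + i) := y')) j) ((w(Suc (a + i) := y')) (Suc j)))
      = (\<Prod>j\<in>{a..<a + i}. ?g j (w j) (w (Suc j)))"
      by (intro prod.cong) auto
    then show "(\<Prod>j\<in>{a..<a + Suc i}. ?g j ((w(Suc (a + i) := y')) j) ((w(Suc (a + i) := y')) (Suc j)))
        * ?g (a + Suc i) ((w(Suc (a + i) := y')) (a + Suc i)) y
      = (\<Prod>j\<in>{a..<a + i}. ?g j (w j) (w (Suc j))) * ?g (a + i) (w (a + i)) y' * ?g (a + Suc i) y' y"
      unfolding ins' by simp
  qed
  also have "\<dots> = (\<Sum>y'\<in>blocks n. path_weight x n a V (Suc i) y' * ?g (a + Suc i) y' y)"
    by (intro sum.cong refl) (simp only: Suc.IH[symmetric] sum_distrib_right)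
  finally show ?case by (simp only: path_weight.simps(2)[of _ _ _ _ "Suc i"])
qed

definition multiples :: "nat \<Rightarrow> (nat \<Rightarrow> 'a::{field,finite}) \<Rightarrow> (nat \<Rightarrow> 'a) set" where
  "multiples n v = {y \<in> blocks n. \<exists>c. y = smul c v}"

lemma multiples_subset: "multiples n v \<subseteq> blocks n" by (auto simp: multiples_def)

lemma card_multiples_le: "card (multiples n (v :: nat \<Rightarrow> 'a::{field,finite})) \<le> CARD('a)"
proof -
  have "multiples n v \<subseteq> range (\<lambda>c. smul c v)" by (auto simp: multiples_def)
  then have "card (multiples n v) \<le> card (range (\<lambda>c. smul c v))" by (intro card_mono) auto
  also have "\<dots> \<le> CARD('a)" by (rule card_image_le) simp
  finally show ?thesis .
qed

lemma smul_cancel: "smul c v = smul d (v :: nat \<Rightarrow> 'a::field) \<Longrightarrow> v \<noteq> zero_block \<Longrightarrow> c = d"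
  by (metis ext mult_right_cancel smul_def)

text \<open>
  From a multiple of a nonzero \<open>V i\<close> only the same multiple of \<open>V (i + 1)\<close> is reached with weight \<open>1\<close>.
  Only where \<open>V\<close> becomes nonzero are all multiples of \<open>V (i + 1)\<close> reached with weight \<open>1\<close>.
\<close>
lemma sum_step_weight_multiples_le:
  fixes V :: "nat \<Rightarrow> nat \<Rightarrow> 'a::{field,finite}" and x :: real
  assumes x: "x \<ge> 0"
  shows "(\<Sum>y\<in>multiples n (V (Suc i)). step_weight x V i y' y) \<le>
    (if \<exists>c. y' = smul c (V i)
     then (if V i = zero_block \<and> V (Suc i) \<noteq> zero_block then real CARD('a) else 1) else 0)
    + CARD('a) * x"
proof -
  let ?G = "multiples n (V (Suc i))"
  let ?A = "{y \<in> ?G. \<exists>c. y' = smul c (V i) \<and> y = smul c (V (Suc i))}"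
  have finG: "finite ?G" using multiples_subset finite_blocks by (rule finite_subset)
  have "(\<Sum>y\<in>?G. step_weight x V i y' y) \<le> (\<Sum>y\<in>?G. (if y \<in> ?A then 1 else 0) + x)"
    using x by (intro sum_mono) (auto simp: step_weight_def)
  also have "\<dots> = card ?A + card ?G * x"
    using finG by (simp add: sum.distrib sum.If_cases Int_def)
  also have "real (card ?G) * x \<le> CARD('a) * x"
    using card_multiples_le x by (intro mult_right_mono) auto
  also have "real (card ?A) \<le> (if \<exists>c. y' = smul c (V i)
     then (if V i = zero_block \<and> V (Suc i) \<noteq> zero_block then real CARD('a) else 1) else 0)"
  proof (cases "\<exists>c. y' = smul c (V i)")
    case False
    then have "?A = {}" by auto
    then show ?thesis using False by simp
  next
    case True': True
    then obtain c where c: "y' = smul c (V i)" by blast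
    show ?thesis
    proof (cases "V i = zero_block \<and> V (Suc i) \<noteq> zero_block")
      case True
      have "card ?A \<le> card ?G" using finG by (intro card_mono) auto
      also have "\<dots> \<le> CARD('a)" by (rule card_multiples_le)
      finally show ?thesis using True True' by simp
    next
      case False
      then have "y = smul c (V (Suc i))" if "y' = smul d (V i)" "y = smul d (V (Suc i))" for d y
        using that c smul_cancel[of c "V i" d] by (cases "V i = zero_block") auto
      then have "?A \<subseteq> {smul c (V (Suc i))}" by blast
      then have "card ?A \<le> card {smul c (V (Suc i))}" by (intro card_mono) auto
      then show ?thesis unfolding if_P[OF True'] if_not_P[OF False] by simp
    qed
  qed
  finally show ?thesis by simp
qed

text \<open>
  Split the weight at step \<open>i\<close> into the mass \<open>T i\<close> on multiples of the current block of \<open>V\<close> and the mass \<open>U i\<close>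
  on all other blocks. Returning to the multiples costs a factor \<open>x\<close> for each of at most \<open>q\<close> targets,
  whereas the \<open>q\<^sup>n\<close> other targets compensate their factor \<open>x\<close>. Hence \<open>T (i + 1) \<le> e i T i + q x (T i + U i)\<close>
  and \<open>U (i + 1) \<le> T i + U i\<close>, with \<open>e i = q\<close> at the single place where the run of \<open>V\<close> begins and \<open>e i = 1\<close>
  elsewhere. So \<open>U\<close> grows linearly, and what flows back to \<open>T\<close> is of order \<open>K\<^sup>2 x\<close>.
\<close>
lemma transfer_mass_bound:
  fixes V :: "nat \<Rightarrow> nat \<Rightarrow> 'a::{field,finite}" and n K a :: nat
  defines "q \<equiv> real CARD('a)"
  defines "x \<equiv> 1 / q ^ n"
  defines "F \<equiv> path_weight x n a V"
  assumes supp: "\<And>j. V j \<noteq> zero_block \<longleftrightarrow> b \<le> j \<and> j \<le> d"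
    and K: "K \<ge> 1" "6 * q\<^sup>2 * (real K)\<^sup>2 * x \<le> 1"
    and i: "i \<le> Suc K"
  shows "(\<Sum>y\<in>multiples n (V (a + i)). F i y) \<le> (if b \<le> a + i then q else 1) * (1 + q\<^sup>2 * x * (real i * (real i + 1)))"
proof -
  have q: "q \<ge> 1" unfolding q_def by (simp add: Suc_leI)
  have x: "x > 0" unfolding x_def using q by simp
  have Nx: "real (card (blocks n :: (nat \<Rightarrow> 'a) set)) * x = 1"
    using q by (simp add: card_blocks x_def q_def)
  have F0: "F i y \<ge> 0" for i y unfolding F_def using x by (simp add: path_weight_nonneg)
  define G where "G i = multiples n (V (a + i))" for i
  define T where "T i = (\<Sum>y\<in>G i. F i y)" for i
  define U where "U i = (\<Sum>y\<in>blocks n - G i. F i y)" for i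
  have G: "G i \<subseteq> blocks n" for i unfolding G_def by (rule multiples_subset)
  have tot: "(\<Sum>y\<in>blocks n. F i y) = T i + U i" for i
    unfolding T_def U_def using sum.subset_diff[OF G[of i] finite_blocks, of "F i"] by simp
  define e where "e i = (if V (a + i) = zero_block \<and> V (Suc (a + i)) \<noteq> zero_block then q else 1)" for i
  have T_Suc: "T (Suc i) \<le> e i * T i + q * x * (T i + U i)" for i
  proof -
    let ?g = "step_weight x V (a + i)"
    have "T (Suc i) = (\<Sum>y\<in>G (Suc i). \<Sum>y'\<in>blocks n. F i y' * ?g y' y)"
      unfolding T_def F_def by simp
    also have "\<dots> = (\<Sum>y'\<in>blocks n. F i y' * (\<Sum>y\<in>G (Suc i). ?g y' y))"
      by (subst sum.swap) (simp add: sum_distrib_left)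
    also have "\<dots> \<le> (\<Sum>y'\<in>blocks n. F i y' * ((if y' \<in> G i then e i else 0) + q * x))"
    proof (intro sum_mono mult_left_mono F0)
      fix y' assume y': "y' \<in> (blocks n :: (nat \<Rightarrow> 'a) set)"
      then have iff: "y' \<in> G i \<longleftrightarrow> (\<exists>c. y' = smul c (V (a + i)))" by (auto simp: G_def multiples_def)
      show "(\<Sum>y\<in>G (Suc i). ?g y' y) \<le> (if y' \<in> G i then e i else 0) + q * x"
        using sum_step_weight_multiples_le[where n = n and V = V and i = "a + i" and y' = y', OF less_imp_le[OF x]]
        unfolding iff e_def q_def G_def[of "Suc i"] add_Suc_right .
    qed
    also have "\<dots> = (\<Sum>y'\<in>blocks n. (if y' \<in> G i then e i * F i y' else 0)) + q * x * (T i + U i)"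
      unfolding tot[symmetric] sum_distrib_left sum.distrib[symmetric] by (intro sum.cong) (auto simp: algebra_simps)
    also have "(\<Sum>y'\<in>blocks n. (if y' \<in> G i then e i * F i y' else 0)) = e i * T i"
      unfolding T_def sum_distrib_left using G[of i] by (simp add: sum.If_cases Int_absorb1)
    finally show ?thesis .
  qed
  have U_Suc: "U (Suc i) \<le> T i + U i" for i
  proof -
    let ?g = "step_weight x V (a + i)"
    have "U (Suc i) = (\<Sum>y\<in>blocks n - G (Suc i). \<Sum>y'\<in>blocks n. F i y' * ?g y' y)"
      unfolding U_def F_def by simp
    also have "\<dots> = (\<Sum>y'\<in>blocks n. F i y' * (\<Sum>y\<in>blocks n - G (Suc i). ?g y' y))"
      by (subst sum.swap) (simp add: sum_distrib_left)
    also have "\<dots> \<le> (\<Sum>y'\<in>blocks n. F i y' * 1)"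
    proof (intro sum_mono mult_left_mono F0)
      fix y'
      have "(\<Sum>y\<in>blocks n - G (Suc i). ?g y' y) = (\<Sum>y\<in>blocks n - G (Suc i). x)"
        by (intro sum.cong) (auto simp: step_weight_def G_def multiples_def)
      also have "\<dots> \<le> (\<Sum>y\<in>(blocks n :: (nat \<Rightarrow> 'a) set). x)"
        using x by (intro sum_mono2) auto
      finally show "(\<Sum>y\<in>blocks n - G (Suc i). ?g y' y) \<le> 1" by (simp add: Nx)
    qed
    finally show ?thesis by (simp add: tot)
  qed
  have small: "q\<^sup>2 * x * (real i * (real i + 1)) \<le> 1" if "i \<le> Suc K" for i
  proof -
    have "real i * (real i + 1) \<le> (real K + 1) * (real K + 2)"
      using that by (intro mult_mono) auto
    also have "\<dots> \<le> 6 * (real K)\<^sup>2"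
    proof -
      have K1: "real K \<ge> 1" using K by simp
      then have "real K \<le> (real K)\<^sup>2" by (simp add: self_le_power)
      moreover have "(real K + 1) * (real K + 2) = (real K)\<^sup>2 + 3 * real K + 2"
        by (simp add: power2_eq_square algebra_simps)
      ultimately show ?thesis using K1 by linarith
    qed
    finally have "q\<^sup>2 * x * (real i * (real i + 1)) \<le> q\<^sup>2 * x * (6 * (real K)\<^sup>2)"
      using x by (intro mult_left_mono) auto
    then show ?thesis using K(2) by (simp add: mult_ac)
  qed
  define s where "s i = (if b \<le> a + i then q else 1)" for i
  have s: "1 \<le> s i" "s i \<le> q" "e i * s i \<le> s (Suc i)" for i
    using q supp[of "a + i"] supp[of "Suc (a + i)"] by (auto simp: s_def e_def)
  have T_2q: "T i \<le> 2 * q" if "T i \<le> s i * (1 + q\<^sup>2 * x * (real i * (real i + 1)))" "i \<le> Suc K" for i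
  proof -
    have "T i \<le> s i * 2"
      using that(1) small[OF that(2)] s(1)[of i] by (elim order_trans) (intro mult_left_mono, auto)
    also have "\<dots> \<le> q * 2" using s(2) by (intro mult_right_mono) auto
    finally show ?thesis by simp
  qed
  \<comment> \<open>The increments \<open>2 q\<^sup>2 x (i + 1)\<close> of the returning mass add up to \<open>q\<^sup>2 x i (i + 1)\<close>.\<close>
  have main: "T i \<le> s i * (1 + q\<^sup>2 * x * (real i * (real i + 1))) \<and> U i \<le> 2 * q * real i" if "i \<le> Suc K" for i
    using that
  proof (induction i)
    case 0
    have z: "zero_block \<in> G 0"
      unfolding G_def multiples_def by (auto intro!: exI[of _ 0] simp: smul_def)
    have "T 0 = 1" using z finite_subset[OF G finite_blocks] by (simp add: T_def F_def)
    moreover have "U 0 = 0" using z by (auto simp: U_def F_def intro!: sum.neutral)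
    ultimately show ?case using s(1)[of 0] by simp
  next
    case (Suc i)
    then have i: "i \<le> Suc K" by simp
    note IH = Suc.IH[OF i]
    have U: "T i + U i \<le> 2 * q * real (Suc i)"
      using T_2q[OF conjunct1[OF IH] i] conjunct2[OF IH] by (simp add: algebra_simps)
    have e0: "e i \<ge> 0" using q by (simp add: e_def)
    have "T (Suc i) \<le> e i * T i + q * x * (T i + U i)" by (rule T_Suc)
    also have "\<dots> \<le> e i * (s i * (1 + q\<^sup>2 * x * (real i * (real i + 1)))) + q * x * (2 * q * real (Suc i))"
      using conjunct1[OF IH] U e0 q x by (intro add_mono mult_left_mono) auto
    also have "\<dots> = (e i * s i) * (1 + q\<^sup>2 * x * (real i * (real i + 1))) + 1 * (q\<^sup>2 * x * (2 * real (Suc i)))"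
      by (simp add: power2_eq_square algebra_simps)
    also have "\<dots> \<le> s (Suc i) * (1 + q\<^sup>2 * x * (real i * (real i + 1))) + s (Suc i) * (q\<^sup>2 * x * (2 * real (Suc i)))"
      using s(1)[of "Suc i"] s(3)[of i] x by (intro add_mono mult_right_mono) auto
    also have "\<dots> = s (Suc i) * (1 + q\<^sup>2 * x * (real (Suc i) * (real (Suc i) + 1)))"
      by (simp add: algebra_simps)
    finally show ?case using U U_Suc[of i] by simp
  qed
  show ?thesis using main[OF i] unfolding T_def G_def s_def by simp
qed

lemma path_weight_le:
  fixes V :: "nat \<Rightarrow> nat \<Rightarrow> 'a::{field,finite}" and n K :: nat
  assumes supp: "\<And>j. V j \<noteq> zero_block \<longleftrightarrow> b \<le> j \<and> j \<le> d"
    and K: "K \<ge> 1" "6 * (real CARD('a))\<^sup>2 * (real K)\<^sup>2 * (1 / real CARD('a) ^ n) \<le> 1"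
  shows "path_weight (1 / real CARD('a) ^ n) n a V (Suc K) zero_block \<le> 2 * real CARD('a)"
proof -
  let ?q = "real CARD('a)" and ?x = "1 / real CARD('a) ^ n"
  have q: "?q \<ge> 1" by (simp add: Suc_leI)
  have "zero_block \<in> multiples n (V (a + Suc K))"
    unfolding multiples_def by (auto intro!: exI[of _ 0] simp: smul_def)
  then have "path_weight ?x n a V (Suc K) zero_block
      \<le> (\<Sum>y\<in>multiples n (V (a + Suc K)). path_weight ?x n a V (Suc K) y)"
    by (intro member_le_sum path_weight_nonneg) (auto intro: finite_subset[OF multiples_subset])
  also have "\<dots> \<le> (if b \<le> a + Suc K then ?q else 1) * (1 + ?q\<^sup>2 * ?x * (real (Suc K) * (real (Suc K) + 1)))"
    by (rule transfer_mass_bound[OF supp K order_refl])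
  also have "\<dots> \<le> ?q * 2"
  proof (intro mult_mono)
    have K1: "real K \<ge> 1" using K by simp
    then have "real K \<le> (real K)\<^sup>2" by (simp add: self_le_power)
    moreover have "real (Suc K) * (real (Suc K) + 1) = (real K)\<^sup>2 + 3 * real K + 2"
      by (simp add: power2_eq_square algebra_simps)
    ultimately have "real (Suc K) * (real (Suc K) + 1) \<le> 6 * (real K)\<^sup>2"
      using K1 by linarith
    then have "?q\<^sup>2 * ?x * (real (Suc K) * (real (Suc K) + 1)) \<le> ?q\<^sup>2 * ?x * (6 * (real K)\<^sup>2)"
      by (intro mult_left_mono) auto
    also have "\<dots> = 6 * ?q\<^sup>2 * (real K)\<^sup>2 * ?x" by (simp only: mult_ac)
    also have "\<dots> \<le> 1" by (rule K(2))
    finally show "1 + ?q\<^sup>2 * ?x * (real (Suc K) * (real (Suc K) + 1)) \<le> 2" by simp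
  qed (use q in auto)
  finally show ?thesis by simp
qed

section \<open>Kernel vectors in a window of block columns\<close>

definition run_vecs :: "nat \<Rightarrow> nat \<Rightarrow> nat \<Rightarrow> (nat \<Rightarrow> nat \<Rightarrow> 'a::{field,finite}) set" where
  "run_vecs b d n = PiE_dflt {b..d} zero_block (\<lambda>_. blocks n - {zero_block})"

lemma run_vecs_nonzero_iff: "V \<in> run_vecs b d n \<Longrightarrow> V j \<noteq> zero_block \<longleftrightarrow> b \<le> j \<and> j \<le> d"
  by (auto simp: run_vecs_def PiE_dflt_def)

lemma run_vecs_block: "V \<in> run_vecs b d n \<Longrightarrow> V j \<in> blocks n"
  by (cases "j \<in> {b..d}") (auto simp: run_vecs_def PiE_dflt_def)

lemma run_vecs_subset: "{b..d} \<subseteq> W \<Longrightarrow> run_vecs b d n \<subseteq> block_vecs W n"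
proof
  fix V assume sub: "{b..d} \<subseteq> W" and V: "V \<in> run_vecs b d n"
  have "V j = zero_block" if "j \<notin> W" for j
    using that sub run_vecs_nonzero_iff[OF V, of j] by auto
  then show "V \<in> block_vecs W n"
    using run_vecs_block[OF V] by (auto simp: block_vecs_def PiE_dflt_def)
qed

lemma finite_run_vecs: "finite (run_vecs b d n :: (nat \<Rightarrow> nat \<Rightarrow> 'a::{field,finite}) set)"
  unfolding run_vecs_def by (rule finite_PiE_dflt) auto

lemma card_run_vecs:
  "card (run_vecs b d n :: (nat \<Rightarrow> nat \<Rightarrow> 'a::{field,finite}) set) = (CARD('a) ^ n - 1) ^ (Suc d - b)"
  unfolding run_vecs_def by (subst card_PiE_dflt) (auto simp: card_Diff_singleton card_blocks)

lemma run_vecs_active_iff: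
  assumes "V \<in> run_vecs b d n" "b \<le> d"
  shows "active V i \<longleftrightarrow> b \<le> i \<and> i \<le> Suc d"
proof -
  have "active V i \<longleftrightarrow> (\<exists>j. (j = i \<or> Suc j = i) \<and> b \<le> j \<and> j \<le> d)"
    unfolding active_def run_vecs_nonzero_iff[OF assms(1)] ..
  also have "\<dots> \<longleftrightarrow> b \<le> i \<and> i \<le> Suc d"
    using assms(2) by (cases "i \<le> d") (auto intro: exI[of _ i] exI[of _ "i - 1"])
  finally show ?thesis .
qed

lemma prod_rows: "(\<Prod>(i, r)\<in>I \<times> {..<n}. h i) = (\<Prod>i\<in>I. h i ^ n :: real)"
  by (simp add: prod.cartesian_product[symmetric])

lemma pr_run_solves_window:
  fixes V :: "nat \<Rightarrow> nat \<Rightarrow> 'a::{field,finite}"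
  assumes S: "finite S" "\<And>i r. a < i \<Longrightarrow> i \<le> Suc (a + K) \<Longrightarrow> r < n \<Longrightarrow> row_pos {a<..a + K} n i r \<subseteq> S"
    and V: "V \<in> run_vecs b d n" and bd: "a < b" "b \<le> d" "d \<le> a + K"
  shows "pr S (\<lambda>f. \<forall>(i, r)\<in>{a<..Suc (a + K)} \<times> {..<n}. solves_row {a<..a + K} n f V i r)
    = (1 / real CARD('a) ^ n) ^ (Suc (Suc d - b))"
proof -
  have V': "V \<in> block_vecs {a<..a + K} n"
    by (rule subsetD[OF run_vecs_subset V]) (use bd in auto)
  have "pr S (\<lambda>f. \<forall>(i, r)\<in>{a<..Suc (a + K)} \<times> {..<n}. solves_row {a<..a + K} n f V i r)
    = (\<Prod>i\<in>{a<..Suc (a + K)}. (if active V i then 1 / real CARD('a) else 1) ^ n)"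
    by (subst pr_solves_rows[OF S(1) _ _ V']) (use S(2) in \<open>auto simp: prod_rows\<close>)
  also have "\<dots> = (\<Prod>i\<in>{a<..Suc (a + K)}. if i \<in> {b..Suc d} then 1 / real CARD('a) ^ n else 1)"
    by (intro prod.cong refl) (auto simp: run_vecs_active_iff[OF V bd(2)] power_one_over)
  also have "\<dots> = (\<Prod>i\<in>{b..Suc d}. 1 / real CARD('a) ^ n)"
    using bd by (intro prod.mono_neutral_cong_right) auto
  also have "\<dots> = (1 / real CARD('a) ^ n) ^ (Suc (Suc d - b))"
    using bd by (simp add: Suc_diff_le)
  finally show ?thesis .
qed

text \<open>
  The expected number of solutions of the window, given that \<open>V\<close> is one, multiplied by the probability
  of this condition.
\<close>
lemma pr_pair_sum_le:
  fixes V :: "nat \<Rightarrow> nat \<Rightarrow> 'a::{field,finite}"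
  assumes S: "finite S" "\<And>i r. a < i \<Longrightarrow> i \<le> Suc (a + K) \<Longrightarrow> r < n \<Longrightarrow> row_pos {a<..a + K} n i r \<subseteq> S"
    and V: "V \<in> run_vecs b d n" and bd: "a < b" "b \<le> d" "d \<le> a + K"
    and K: "K \<ge> 1" "6 * (real CARD('a))\<^sup>2 * (real K)\<^sup>2 * (1 / real CARD('a) ^ n) \<le> 1"
  defines "sol f w \<equiv> (\<forall>(i, r)\<in>{a<..Suc (a + K)} \<times> {..<n}. solves_row {a<..a + K} n f w i r)"
  shows "(\<Sum>w\<in>block_vecs {a<..a + K} n. pr S (\<lambda>f :: _ \<Rightarrow> 'a. sol f V \<and> sol f w))
    \<le> 2 * real CARD('a) * pr S (\<lambda>f :: _ \<Rightarrow> 'a. sol f V)"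
proof -
  let ?W = "{a<..a + K}" and ?x = "1 / real CARD('a) ^ n"
  have V': "V \<in> block_vecs ?W n"
    by (rule subsetD[OF run_vecs_subset V]) (use bd in auto)
  have eq: "pr S (\<lambda>f :: _ \<Rightarrow> 'a. sol f V \<and> sol f w) = pr S (\<lambda>f :: _ \<Rightarrow> 'a. sol f V) *
      ((\<Prod>j\<in>{a..<a + K}. step_weight ?x V j (w j) (w (Suc j))) * step_weight ?x V (a + K) (w (a + K)) zero_block)"
    if w: "w \<in> block_vecs ?W n" for w
  proof -
    have par: "parallel V w (Suc j) \<longleftrightarrow> (\<exists>c. w j = smul c (V j) \<and> w (Suc j) = smul c (V (Suc j)))" for j
      unfolding parallel_def by auto
    have "(\<Prod>(i, r)\<in>{a<..Suc (a + K)} \<times> {..<n}. if parallel V w i then 1 else 1 / real CARD('a))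
      = (\<Prod>i\<in>{a<..Suc (a + K)}. (if parallel V w i then 1 else 1 / real CARD('a)) ^ n)"
      by (rule prod_rows)
    also have "\<dots> = (\<Prod>j\<in>{a..a + K}. (if parallel V w (Suc j) then 1 else 1 / real CARD('a)) ^ n)"
      by (rule prod.reindex_bij_witness[where i = Suc and j = "\<lambda>i. i - 1"]) auto
    also have "\<dots> = (\<Prod>j\<in>{a..a + K}. step_weight ?x V j (w j) (w (Suc j)))"
      by (intro prod.cong refl) (auto simp: step_weight_def par power_one_over)
    also have "{a..a + K} = insert (a + K) {a..<a + K}" by auto
    also have "(\<Prod>j\<in>\<dots>. step_weight ?x V j (w j) (w (Suc j)))
      = (\<Prod>j\<in>{a..<a + K}. step_weight ?x V j (w j) (w (Suc j))) * step_weight ?x V (a + K) (w (a + K)) zero_block"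
      using block_vecs_outside[OF w, of "Suc (a + K)"] by simp
    finally show ?thesis
      unfolding sol_def by (subst pr_solves_rows_two[OF S(1) _ _ V' w]) (use S(2) in auto)
  qed
  have "(\<Sum>w\<in>block_vecs ?W n. pr S (\<lambda>f :: _ \<Rightarrow> 'a. sol f V \<and> sol f w))
    = pr S (\<lambda>f :: _ \<Rightarrow> 'a. sol f V) * path_weight ?x n a V (Suc K) zero_block"
    unfolding sum_block_vecs_eq_path_weight[symmetric] sum_distrib_left by (intro sum.cong refl eq)
  also have "\<dots> \<le> pr S (\<lambda>f :: _ \<Rightarrow> 'a. sol f V) * (2 * real CARD('a))"
    by (intro mult_left_mono path_weight_le[OF run_vecs_nonzero_iff[OF V] K]) auto
  finally show ?thesis by (simp add: mult_ac)
qed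

text \<open>
  The exact value is \<open>x (1 - x)\<^sup>l\<close> with \<open>l \<le> K\<close> the length of the run, and \<open>K x \<le> 1/2\<close>.
\<close>
lemma run_vecs_expected_count:
  assumes S: "finite S" "\<And>i r. a < i \<Longrightarrow> i \<le> Suc (a + K) \<Longrightarrow> r < n \<Longrightarrow> row_pos {a<..a + K} n i r \<subseteq> S"
    and bd: "a < b" "b \<le> d" "d \<le> a + K" and x: "2 * real K * (1 / real CARD('a) ^ n) \<le> 1"
  shows "(\<Sum>V\<in>run_vecs b d n. pr S (\<lambda>f :: _ \<Rightarrow> 'a::{field,finite}.
      \<forall>(i, r)\<in>{a<..Suc (a + K)} \<times> {..<n}. solves_row {a<..a + K} n f V i r))
    \<ge> (1 / real CARD('a) ^ n) / 2"
proof -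
  define x where "x = 1 / real CARD('a) ^ n"
  define m where "m = Suc d - b"
  have q: "real CARD('a) \<ge> 1" by (simp add: Suc_leI)
  have x0: "x > 0" "x \<le> 1" using q by (auto simp: x_def)
  have Nx: "(real (CARD('a) ^ n) - 1) * x = 1 - x" using q by (simp add: x_def field_simps)
  have "x / 2 \<le> x * (1 - real m * x)"
  proof -
    have "real m * x \<le> real K * x" using bd x0 by (intro mult_right_mono) (auto simp: m_def)
    also have "\<dots> \<le> 1 / 2" using x by (simp add: x_def)
    finally have "1 / 2 \<le> 1 - real m * x" by simp
    then have "x * (1 / 2) \<le> x * (1 - real m * x)" using x0 by (intro mult_left_mono) auto
    then show ?thesis by simp
  qed
  also have "\<dots> \<le> x * (1 - x) ^ m"
    using Bernoulli_inequality[of "- x" m] x0 by (intro mult_left_mono) auto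
  also have "\<dots> = real (card (run_vecs b d n :: (nat \<Rightarrow> nat \<Rightarrow> 'a) set)) * x ^ Suc m"
    unfolding card_run_vecs m_def[symmetric] Nx[symmetric] by (simp add: power_mult_distrib Suc_leI of_nat_diff)
  also have "\<dots> = (\<Sum>V\<in>run_vecs b d n. pr S (\<lambda>f :: _ \<Rightarrow> 'a.
      \<forall>(i, r)\<in>{a<..Suc (a + K)} \<times> {..<n}. solves_row {a<..a + K} n f V i r))"
    unfolding x_def m_def
    by (subst sum.cong[OF refl pr_run_solves_window[OF S _ bd]]) simp_all
  finally show ?thesis unfolding x_def .
qed

text \<open>
  There are about \<open>K\<^sup>2 / 2\<close> runs inside the window. Each contributes at least \<open>x / 2\<close> to the expected number of
  solutions, and the second moment method applies with the constant \<open>2 q\<close>.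
\<close>
lemma pr_window_kernel_ge:
  assumes S: "finite S" "\<And>i r. a < i \<Longrightarrow> i \<le> Suc (a + K) \<Longrightarrow> r < n \<Longrightarrow> row_pos {a<..a + K} n i r \<subseteq> S"
    and K: "K \<ge> 1" "6 * (real CARD('a))\<^sup>2 * (real K)\<^sup>2 * (1 / real CARD('a) ^ n) \<le> 1"
  shows "pr S (\<lambda>f :: _ \<Rightarrow> 'a::{field,finite}. \<exists>V\<in>block_vecs {a<..a + K} n. V \<noteq> (\<lambda>_. zero_block) \<and>
      (\<forall>(i, r)\<in>{a<..Suc (a + K)} \<times> {..<n}. solves_row {a<..a + K} n f V i r))
    \<ge> (real K)\<^sup>2 * (1 / real CARD('a) ^ n) / (8 * real CARD('a))"
proof -
  let ?W = "{a<..a + K}" and ?q = "real CARD('a)"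
  define x where "x = 1 / ?q ^ n"
  define sol where "sol f w \<longleftrightarrow> (\<forall>(i, r)\<in>{a<..Suc (a + K)} \<times> {..<n}. solves_row ?W n f w i r)"
    for f and w :: "nat \<Rightarrow> nat \<Rightarrow> 'a"
  \<comment> \<open>A pair \<open>(j, l)\<close> with \<open>l < j \<le> K\<close> encodes the run from \<open>a + l + 1\<close> to \<open>a + j\<close>.\<close>
  define P where "P = (SIGMA j:{..K}. {..<j})"
  define run where "run p = (run_vecs (Suc (a + snd p)) (a + fst p) n :: (nat \<Rightarrow> nat \<Rightarrow> 'a) set)" for p
  define I where "I = (\<Union>p\<in>P. run p)"
  have q: "?q \<ge> 1" by (simp add: Suc_leI)
  have x0: "x > 0" using q by (simp add: x_def)
  have finP: "finite P" by (simp add: P_def)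
  have finI: "finite I" unfolding I_def run_def using finP finite_run_vecs by blast
  have P: "snd p < fst p \<and> fst p \<le> K" if "p \<in> P" for p using that by (auto simp: P_def)
  have Ix: "I \<subseteq> block_vecs ?W n"
    unfolding I_def run_def using P by (intro UN_least run_vecs_subset) force
  have small: "2 * real K * x \<le> 1"
  proof -
    have "real K \<le> (real K)\<^sup>2" using K(1) by (simp add: self_le_power)
    also have "\<dots> \<le> ?q\<^sup>2 * (real K)\<^sup>2" using q by (simp add: mult_le_cancel_right1)
    finally have "2 * real K \<le> 6 * (?q\<^sup>2 * (real K)\<^sup>2)" by linarith
    then have "2 * real K * x \<le> 6 * (?q\<^sup>2 * (real K)\<^sup>2) * x" using x0 by (intro mult_right_mono) auto
    also have "\<dots> = 6 * ?q\<^sup>2 * (real K)\<^sup>2 * (1 / ?q ^ n)" by (simp add: x_def)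
    also note K(2)
    finally show ?thesis .
  qed
  have disj: "run p \<inter> run p' = {}" if "p \<in> P" "p' \<in> P" "p \<noteq> p'" for p p'
  proof (rule ccontr)
    assume "run p \<inter> run p' \<noteq> {}"
    then obtain V where V: "V \<in> run p" "V \<in> run p'" by blast
    have "i \<in> {Suc (a + snd p)..a + fst p} \<longleftrightarrow> i \<in> {Suc (a + snd p')..a + fst p'}" for i
      using run_vecs_nonzero_iff[OF V(1)[unfolded run_def], of i]
        run_vecs_nonzero_iff[OF V(2)[unfolded run_def], of i]
      unfolding atLeastAtMost_iff by (rule trans[OF sym])
    then have "{Suc (a + snd p)..a + fst p} = {Suc (a + snd p')..a + fst p'}" by blast
    then show False using that P[OF that(1)] P[OF that(2)] by (auto simp: Icc_eq_Icc prod_eq_iff)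
  qed
  have "(real K)\<^sup>2 / 2 \<le> real (card P)"
  proof -
    have "card P = (\<Sum>j\<le>K. j)" unfolding P_def by simp
    then have "2 * card P = K * (K + 1)" using gauss_sum_nat[of K] by (simp add: atMost_atLeast0)
    then have "2 * real (card P) = real K * (real K + 1)" by (metis of_nat_1 of_nat_add of_nat_mult of_nat_numeral)
    then show ?thesis by (simp add: power2_eq_square algebra_simps)
  qed
  then have "(real K)\<^sup>2 / 2 * (x / 2) \<le> real (card P) * (x / 2)" using x0 by (intro mult_right_mono) auto
  also have "\<dots> = (\<Sum>p\<in>P. x / 2)" by simp
  also have "\<dots> \<le> (\<Sum>p\<in>P. \<Sum>V\<in>run p. pr S (\<lambda>f. sol f V))"
    unfolding run_def sol_def x_def
    using P small by (intro sum_mono run_vecs_expected_count[OF S]) (auto simp: x_def Suc_le_eq)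
  also have "\<dots> = (\<Sum>V\<in>I. pr S (\<lambda>f. sol f V))"
    unfolding I_def
    by (rule sum.UNION_disjoint[symmetric, OF finP]) (simp add: run_def finite_run_vecs, use disj in blast)
  finally have "(real K)\<^sup>2 * x / 4 \<le> (\<Sum>V\<in>I. pr S (\<lambda>f. sol f V))" by simp
  then have "(real K)\<^sup>2 * x / 4 / (2 * ?q) \<le> (\<Sum>V\<in>I. pr S (\<lambda>f. sol f V)) / (2 * ?q)"
    using q by (intro divide_right_mono) auto
  also have "\<dots> \<le> pr S (\<lambda>f. \<exists>V\<in>I. sol f V)"
  proof (rule prob_Ex_ge_second_moment[OF finI])
    fix V assume "V \<in> I"
    then obtain p where p: "p \<in> P" "V \<in> run p" unfolding I_def by blast
    have "(\<Sum>w\<in>I. pr S (\<lambda>f. sol f V \<and> sol f w)) \<le> (\<Sum>w\<in>block_vecs ?W n. pr S (\<lambda>f. sol f V \<and> sol f w))"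
      using Ix by (intro sum_mono2 finite_block_vecs) auto
    also have "\<dots> \<le> 2 * ?q * pr S (\<lambda>f. sol f V)"
      unfolding sol_def using p P[OF p(1)] unfolding run_def by (intro pr_pair_sum_le[OF S _ _ _ _ K]) auto
    finally show "(\<Sum>w\<in>I. pr S (\<lambda>f. sol f V \<and> sol f w)) \<le> 2 * ?q * pr S (\<lambda>f. sol f V)" .
  qed (use q in auto)
  also have "\<dots> \<le> pr S (\<lambda>f. \<exists>V\<in>block_vecs ?W n. V \<noteq> (\<lambda>_. zero_block) \<and> sol f V)"
  proof (rule pr_mono)
    fix f assume "\<exists>V\<in>I. sol f V"
    then obtain V where V: "V \<in> I" "sol f V" by blast
    then obtain p where p: "p \<in> P" "V \<in> run p" unfolding I_def by blast
    have "V (a + fst p) \<noteq> zero_block"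
      using p P[OF p(1)] run_vecs_nonzero_iff[of V] unfolding run_def by auto
    then have "V \<noteq> (\<lambda>_. zero_block)" by metis
    then show "\<exists>V\<in>block_vecs ?W n. V \<noteq> (\<lambda>_. zero_block) \<and> sol f V" using V Ix by blast
  qed
  finally show ?thesis unfolding sol_def x_def by simp
qed

section \<open>From random blocks to equations\<close>

definition entries :: "(nat \<times> nat \<Rightarrow> 'a mat) \<Rightarrow> (nat \<times> nat) \<times> (nat \<times> nat) \<Rightarrow> 'a" where
  "entries \<omega> p = \<omega> (fst p) $$ snd p"

text \<open>
  All assignments of values to finitely many entries are equally likely, since each of them fixes the
  same number of blocks; so these entries are independent and uniform.
\<close>
lemma block_space_event:
  fixes Q :: "((nat \<times> nat) \<times> (nat \<times> nat) \<Rightarrow> 'a::{field,finite}) \<Rightarrow> bool"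
  assumes J: "finite J" "J \<subseteq> band" and Q: "depends_on (J \<times> ({..<n} \<times> {..<n})) Q"
  shows "{\<omega> \<in> space (block_space n). Q (entries \<omega>)} \<in> sets (block_space n)"
    and "\<P>(\<omega> in block_space n. Q (entries \<omega>)) = pr (J \<times> ({..<n} \<times> {..<n})) Q"
proof -
  let ?B = "block_space n :: (nat \<times> nat \<Rightarrow> 'a mat) measure"
  let ?U = "uniform_count_measure (carrier_mat n n :: 'a mat set)"
  define S where "S = J \<times> ({..<n} \<times> {..<n})"
  let ?H = "PiE_dflt S 0 (\<lambda>_. UNIV :: 'a set)"
  interpret U: prob_space ?U by (rule prob_space_uniform_mat)
  interpret PP: product_prob_space "\<lambda>_ :: nat \<times> nat. ?U" band by unfold_locales
  interpret B: prob_space ?B by (rule prob_space_block_space)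
  have finS: "finite S" using J by (simp add: S_def)
  then have finH: "finite ?H" by (intro finite_PiE_dflt) auto
  define M where "M h b = mat n n (\<lambda>rc. h (b, rc))" for h :: "(nat \<times> nat) \<times> (nat \<times> nat) \<Rightarrow> 'a" and b
  define E where "E h = {\<omega> \<in> space ?B. \<forall>p\<in>S. entries \<omega> p = h p}" for h
  define c :: real where "c = (\<Prod>b\<in>J. 1 / card (carrier_mat n n :: 'a mat set))"
  have sp: "\<omega> b \<in> carrier_mat n n" if "\<omega> \<in> space ?B" "b \<in> J" for \<omega> b
    using that J by (auto simp: block_space_def space_PiM space_uniform_count_measure)
  have M_eq: "\<omega> b = M h b \<longleftrightarrow> (\<forall>r<n. \<forall>s<n. entries \<omega> (b, (r, s)) = h (b, (r, s)))"
    if "\<omega> \<in> space ?B" "b \<in> J" for \<omega> h b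
    using sp[OF that] by (auto simp: M_def entries_def mat_eq_iff)
  have E_emb: "E h = PP.emb band J (PiE J (\<lambda>b. {M h b}))" for h
  proof -
    have "E h = {\<omega> \<in> space ?B. \<forall>b\<in>J. \<omega> b = M h b}"
      unfolding E_def S_def by (auto simp: M_eq)
    also have "\<dots> = PP.emb band J (PiE J (\<lambda>b. {M h b}))"
      using J by (auto simp: prod_emb_def block_space_def space_PiM PiE_iff intro: extensional_arb)
    finally show ?thesis .
  qed
  have E_sets: "E h \<in> sets ?B" for h
    unfolding E_emb block_space_def
    by (intro sets_PiM_I J) (auto simp: M_def sets_uniform_count_measure)
  have E_prob: "measure ?B (E h) = c" for h
    unfolding E_emb block_space_def c_def
    by (subst PP.measure_PiM_emb[OF J(2,1)])
      (auto simp: M_def sets_uniform_count_measure measure_uniform_count_measure finite_carrier_mat)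
  have event: "{\<omega> \<in> space ?B. R (entries \<omega>)} \<in> sets ?B"
    "measure ?B {\<omega> \<in> space ?B. R (entries \<omega>)} = card {h \<in> ?H. R h} * c"
    if R: "depends_on S R" for R
  proof -
    have eq: "{\<omega> \<in> space ?B. R (entries \<omega>)} = (\<Union>h\<in>{h \<in> ?H. R h}. E h)"
    proof (intro equalityI subsetI)
      fix \<omega> assume w: "\<omega> \<in> {\<omega> \<in> space ?B. R (entries \<omega>)}"
      let ?h = "\<lambda>p. if p \<in> S then entries \<omega> p else 0"
      have "R ?h" using w R[unfolded depends_on_def, rule_format, of ?h "entries \<omega>"] by simp
      then have "?h \<in> {h \<in> ?H. R h}" by (auto simp: PiE_dflt_def)
      moreover have "\<omega> \<in> E ?h" using w by (auto simp: E_def)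
      ultimately show "\<omega> \<in> (\<Union>h\<in>{h \<in> ?H. R h}. E h)" by blast
    next
      fix \<omega> assume "\<omega> \<in> (\<Union>h\<in>{h \<in> ?H. R h}. E h)"
      then obtain h where h: "R h" "\<omega> \<in> E h" by blast
      then show "\<omega> \<in> {\<omega> \<in> space ?B. R (entries \<omega>)}"
        using R[unfolded depends_on_def, rule_format, of "entries \<omega>" h] by (auto simp: E_def)
    qed
    show "{\<omega> \<in> space ?B. R (entries \<omega>)} \<in> sets ?B"
      unfolding eq using finH E_sets by (intro sets.finite_UN) auto
    have disj: "disjoint_family_on E {h \<in> ?H. R h}"
      unfolding disjoint_family_on_def
    proof (intro ballI impI, rule ccontr)
      fix h h' assume h: "h \<in> {h \<in> ?H. R h}" "h' \<in> {h \<in> ?H. R h}" "h \<noteq> h'" "E h \<inter> E h' \<noteq> {}"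
      then have "\<forall>p\<in>S. h p = h' p" by (auto simp: E_def)
      moreover have "\<forall>p. p \<notin> S \<longrightarrow> h p = h' p" using h by (auto simp: PiE_dflt_def)
      ultimately show False using h(3) by blast
    qed
    have "measure ?B (\<Union>h\<in>{h \<in> ?H. R h}. E h) = (\<Sum>h\<in>{h \<in> ?H. R h}. measure ?B (E h))"
      using finH E_sets disj by (intro B.finite_measure_finite_Union) auto
    then show "measure ?B {\<omega> \<in> space ?B. R (entries \<omega>)} = card {h \<in> ?H. R h} * c"
      unfolding eq by (simp add: E_prob)
  qed
  \<comment> \<open>The common probability \<open>c\<close> of the assignments is determined by their number.\<close>
  have "1 = card ?H * c"
    using event(2)[of "\<lambda>_. True"] B.prob_space by (simp add: depends_on_def)
  moreover from this have "real (card ?H) \<noteq> 0" by (metis mult_zero_left zero_neq_one)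
  ultimately have c: "c = 1 / card ?H" by (simp add: eq_divide_eq mult.commute)
  show "{\<omega> \<in> space ?B. Q (entries \<omega>)} \<in> sets ?B"
    using Q unfolding S_def[symmetric] by (rule event(1))
  show "\<P>(\<omega> in ?B. Q (entries \<omega>)) = pr (J \<times> ({..<n} \<times> {..<n})) Q"
    using event(2)[OF Q[folded S_def]] unfolding S_def[symmetric] pr_eq_card[OF finS] c by simp
qed

definition to_blocks :: "nat \<Rightarrow> nat \<Rightarrow> 'a::zero vec \<Rightarrow> nat \<Rightarrow> nat \<Rightarrow> 'a" where
  "to_blocks n m v j c = (if 1 \<le> j \<and> j \<le> m \<and> c < n then v $ ((j - 1) * n + c) else 0)"

definition of_blocks :: "nat \<Rightarrow> nat \<Rightarrow> (nat \<Rightarrow> nat \<Rightarrow> 'a) \<Rightarrow> 'a vec" where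
  "of_blocks n m V = vec (m * n) (\<lambda>t. V (t div n + 1) (t mod n))"

lemma of_blocks_carrier [simp]: "of_blocks n m V \<in> carrier_vec (m * n)"
  by (simp add: of_blocks_def)

lemma to_blocks_in_block_vecs: "to_blocks n m v \<in> block_vecs {1..m} n"
  by (auto simp: block_vecs_def blocks_def PiE_dflt_def to_blocks_def fun_eq_iff)

lemma index_less_mult: "j < m \<Longrightarrow> c < n \<Longrightarrow> j * n + c < m * (n :: nat)"
proof -
  assume "j < m" "c < n"
  then have "j * n + c < Suc j * n" by simp
  also have "\<dots> \<le> m * n" using \<open>j < m\<close> by (intro mult_right_mono) auto
  finally show ?thesis .
qed

lemma to_blocks_of_blocks:
  assumes "V \<in> block_vecs {1..m} n"
  shows "to_blocks n m (of_blocks n m V) = V"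
proof (intro ext)
  fix j c
  show "to_blocks n m (of_blocks n m V) j c = V j c"
  proof (cases "1 \<le> j \<and> j \<le> m \<and> c < n")
    case True
    then have "(j - 1) * n + c < m * n" by (intro index_less_mult) auto
    then show ?thesis using True by (simp add: to_blocks_def of_blocks_def)
  next
    case False
    then have "V j c = 0"
      using block_vecs_outside[OF assms, of j] block_vecs_entry[OF assms, of c j] by auto
    then show ?thesis using False by (auto simp: to_blocks_def)
  qed
qed

lemma supp_eq: "supp n m v = {i \<in> {1..m}. to_blocks n m v i \<noteq> zero_block}"
  by (auto simp: supp_def vec_block_def to_blocks_def vec_eq_iff fun_eq_iff)

lemma to_blocks_eq_0:
  assumes "v \<in> carrier_vec (m * n)" "\<And>j. to_blocks n m v j = zero_block"
  shows "v = 0\<^sub>v (m * n)"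
proof (rule eq_vecI)
  fix t assume "t < dim_vec (0\<^sub>v (m * n) :: 'a vec)"
  then have t: "t < m * n" by simp
  then have "n > 0" by (cases n) auto
  then have "t div n < m" "t mod n < n" using t by (auto simp: div_less_iff_less_mult)
  then show "v $ t = 0\<^sub>v (m * n) $ t"
    using t fun_cong[OF assms(2)[of "t div n + 1"], of "t mod n"] by (simp add: to_blocks_def)
qed (use assms(1) in auto)

lemma sum_lessThan_mult: "(\<Sum>t<m * n. f t) = (\<Sum>j<m. \<Sum>c<n. f (j * n + c :: nat))"
proof -
  have "(\<Sum>t<m * n. f t) = (\<Sum>j<m. sum f {j * n..<j * n + n})" by (rule sum.nat_group[symmetric])
  moreover have "sum f {j * n..<j * n + n} = (\<Sum>c<n. f (j * n + c))" for j
    by (subst sum.atLeastLessThan_shift_0) (simp add: atLeast0LessThan)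
  ultimately show ?thesis by simp
qed

text \<open>
  Block row and row inside the block of the rows kept in $\widehat C_{2k}$, for \<open>m = k + 1\<close>.
\<close>
definition hat_rows :: "nat \<Rightarrow> nat \<Rightarrow> (nat \<times> nat) set" where
  "hat_rows n m = {(i, r). 1 \<le> i \<and> i \<le> m + 1 \<and> r < n \<and>
     (i = 1 \<longrightarrow> n div 2 \<le> r) \<and> (i = m + 1 \<longrightarrow> r < n div 2)}"

lemma lin_row_pos:
  "lin (row_pos W n i r) (\<lambda>p. V (snd (fst p)) (snd (snd p))) f =
    (\<Sum>j\<in>{j \<in> W. j = i \<or> Suc j = i}. \<Sum>c<n. f ((i, j), (r, c)) * V j c)"
proof -
  let ?J = "{j \<in> W. j = i \<or> Suc j = i}"
  have "(\<Sum>j\<in>?J. \<Sum>c<n. f ((i, j), (r, c)) * V j c) = (\<Sum>t\<in>?J \<times> {..<n}. f ((i, fst t), (r, snd t)) * V (fst t) (snd t))"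
    by (simp add: sum.cartesian_product case_prod_beta)
  also have "\<dots> = lin (row_pos W n i r) (\<lambda>p. V (snd (fst p)) (snd (snd p))) f"
    unfolding lin_def
    by (rule sum.reindex_bij_witness[where i = "\<lambda>p. (snd (fst p), snd (snd p))" and j = "\<lambda>t. ((i, fst t), (r, snd t))"])
      (auto simp: row_pos_def)
  finally show ?thesis ..
qed

lemma C_hat_mult_index:
  assumes v: "v \<in> carrier_vec ((k + 1) * n)" and t: "t < (k + 1) * n"
  defines "i \<equiv> (t + n div 2) div n + 1" and "r \<equiv> (t + n div 2) mod n"
  shows "(C_hat n \<omega> k *\<^sub>v v) $ t =
    lin (row_pos {1..k + 1} n i r) (\<lambda>p. to_blocks n (k + 1) v (snd (fst p)) (snd (snd p))) (entries \<omega>)"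
proof -
  let ?V = "to_blocks n (k + 1) v"
  have n: "n > 0" using t by (cases n) auto
  then have r: "r < n" by (simp add: r_def)
  have h: "n div 2 < n" using n by simp
  have t': "t + n div 2 < (k + 1 + 1) * n" using t h by (simp add: algebra_simps)
  have "(C_hat n \<omega> k *\<^sub>v v) $ t = (\<Sum>s<(k + 1) * n. C_hat n \<omega> k $$ (t, s) * v $ s)"
    using v t by (simp add: scalar_prod_def C_hat_def atLeast0LessThan)
  also have "\<dots> = (\<Sum>s<(k + 1) * n. block n \<omega> i (s div n + 1) $$ (r, s mod n) * v $ s)"
    using t t' unfolding i_def r_def
    by (intro sum.cong refl) (simp only: C_hat_def C_mat_def index_mat lessThan_iff prod.case)
  also have "\<dots> = (\<Sum>j<k + 1. \<Sum>c<n. block n \<omega> i (j + 1) $$ (r, c) * v $ (j * n + c))"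
    unfolding sum_lessThan_mult by (intro sum.cong refl) simp
  also have "\<dots> = (\<Sum>j\<in>{1..k + 1}. \<Sum>c<n. block n \<omega> i j $$ (r, c) * ?V j c)"
    by (rule sum.reindex_bij_witness[where i = "\<lambda>j. j - 1" and j = Suc]) (auto simp: to_blocks_def intro!: sum.cong)
  also have "\<dots> = (\<Sum>j\<in>{j \<in> {1..k + 1}. j = i \<or> Suc j = i}. \<Sum>c<n. block n \<omega> i j $$ (r, c) * ?V j c)"
    using r by (intro sum.mono_neutral_right) (auto simp: block_def band_def intro!: sum.neutral)
  also have "\<dots> = (\<Sum>j\<in>{j \<in> {1..k + 1}. j = i \<or> Suc j = i}. \<Sum>c<n. entries \<omega> ((i, j), (r, c)) * ?V j c)"
    by (intro sum.cong refl) (auto simp: block_def band_def entries_def i_def)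
  finally show ?thesis by (simp only: lin_row_pos)
qed

lemma C_hat_kernel_iff:
  assumes v: "v \<in> carrier_vec ((k + 1) * n)" and n: "n > 0"
  shows "C_hat n \<omega> k *\<^sub>v v = 0\<^sub>v ((k + 1) * n) \<longleftrightarrow>
    (\<forall>(i, r)\<in>hat_rows n (k + 1). solves_row {1..k + 1} n (entries \<omega>) (to_blocks n (k + 1) v) i r)"
proof -
  let ?h = "n div 2" and ?m = "k + 1"
  have h: "?h < n" using n by simp
  have rows: "hat_rows n ?m = (\<lambda>t. ((t + ?h) div n + 1, (t + ?h) mod n)) ` {..<?m * n}"
  proof (intro equalityI subsetI)
    fix \<rho> assume "\<rho> \<in> hat_rows n ?m"
    then obtain i r where ir: "\<rho> = (i, r)" "1 \<le> i" "i \<le> ?m + 1" "r < n" "i = 1 \<longrightarrow> ?h \<le> r" "i = ?m + 1 \<longrightarrow> r < ?h"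
      by (auto simp: hat_rows_def)
    define R where "R = (i - 1) * n + r"
    have "?h \<le> R"
    proof (cases "i = 1")
      case False
      then have "1 * n \<le> (i - 1) * n" using ir(2) by (intro mult_right_mono) auto
      then have "?h \<le> (i - 1) * n" using h by linarith
      then show ?thesis by (simp add: R_def)
    qed (use ir in \<open>simp add: R_def\<close>)
    moreover have "R < ?m * n + ?h"
    proof (cases "i = ?m + 1")
      case False
      then have "R < ?m * n" unfolding R_def using ir by (intro index_less_mult) auto
      then show ?thesis by simp
    qed (use ir in \<open>simp add: R_def\<close>)
    ultimately have "R - ?h < ?m * n" "R - ?h + ?h = R" by linarith+
    moreover have "R div n + 1 = i" "R mod n = r" using ir n by (auto simp: R_def)
    ultimately show "\<rho> \<in> (\<lambda>t. ((t + ?h) div n + 1, (t + ?h) mod n)) ` {..<?m * n}"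
      unfolding ir(1) by (intro image_eqI[of _ _ "R - ?h"]) auto
  next
    fix \<rho> assume "\<rho> \<in> (\<lambda>t. ((t + ?h) div n + 1, (t + ?h) mod n)) ` {..<?m * n}"
    then obtain t where t: "\<rho> = ((t + ?h) div n + 1, (t + ?h) mod n)" "t < ?m * n" by auto
    define R where "R = t + ?h"
    have R: "?h \<le> R" "R < ?m * n + ?h" using t by (auto simp: R_def)
    have "R < (?m + 1) * n" using R(2) h by (simp add: algebra_simps)
    then have "R div n < ?m + 1" using n by (simp only: div_less_iff_less_mult)
    moreover have "R mod n < n" using n by simp
    moreover have "R mod n \<ge> ?h" if "R div n = 0" using that R(1) n by (metis div_mult_mod_eq mult_zero_left add_0)
    moreover have "R mod n < ?h" if "R div n = ?m"
    proof -
      have "R = ?m * n + R mod n" using that div_mult_mod_eq[of R n] by simp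
      then show ?thesis using R(2) by linarith
    qed
    ultimately show "\<rho> \<in> hat_rows n ?m" unfolding t(1) R_def[symmetric] hat_rows_def by auto
  qed
  have "C_hat n \<omega> k *\<^sub>v v = 0\<^sub>v (?m * n) \<longleftrightarrow> (\<forall>t<?m * n. (C_hat n \<omega> k *\<^sub>v v) $ t = 0)"
    by (auto simp: vec_eq_iff C_hat_def)
  also have "\<dots> \<longleftrightarrow> (\<forall>(i, r)\<in>hat_rows n ?m. solves_row {1..?m} n (entries \<omega>) (to_blocks n ?m v) i r)"
    unfolding rows solves_row_def using C_hat_mult_index[OF v, of _ \<omega>] by (auto simp del: mult_Suc)
  finally show ?thesis .
qed

section \<open>Delocalization\<close>

lemma solves_row_cong:
  assumes "\<And>j. j = i \<or> Suc j = i \<Longrightarrow> V j = V' j"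
  shows "solves_row W n f V i r = solves_row W n f V' i r"
  unfolding solves_row_def lin_def
  by (intro arg_cong[where f = "\<lambda>t. t = 0"] sum.cong refl) (auto simp: row_pos_def assms)

lemma solves_row_zero: "(\<And>j. j = i \<or> Suc j = i \<Longrightarrow> V j = zero_block) \<Longrightarrow> solves_row W n f V i r"
  unfolding solves_row_def lin_def by (intro sum.neutral) (auto simp: row_pos_def)

definition proper_runs :: "nat \<Rightarrow> (nat \<times> nat) set" where
  "proper_runs m = {(b, d). 1 \<le> b \<and> b \<le> d \<and> d \<le> m \<and> (b, d) \<noteq> (1, m)}"

text \<open>
  Keep only the first maximal run of nonzero blocks. A block row that meets the run sees outside of it
  only blocks that were already zero, so it is still satisfied.
\<close>
lemma exists_proper_run:
  assumes V: "V \<in> block_vecs {1..m} n" and ne: "V j1 \<noteq> zero_block"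
    and j0: "1 \<le> j0" "j0 \<le> m" "V j0 = zero_block"
    and sol: "\<forall>(i, r)\<in>R. solves_row {1..m} n f V i r"
  shows "\<exists>(b, d)\<in>proper_runs m. \<exists>V'\<in>run_vecs b d n. \<forall>(i, r)\<in>R. solves_row {1..m} n f V' i r"
proof -
  define b where "b = (LEAST j. V j \<noteq> zero_block)"
  have b: "V b \<noteq> zero_block" unfolding b_def using ne by (rule LeastI)
  have below: "V j = zero_block" if "j < b" for j
    using not_less_Least[of j "\<lambda>j. V j \<noteq> zero_block"] that unfolding b_def by blast
  have bm: "1 \<le> b" "b \<le> m" using b block_vecs_outside[OF V, of b] by auto
  define e where "e = (LEAST e. b < e \<and> V e = zero_block)"
  have ex: "b < m + 1 \<and> V (m + 1) = zero_block" using bm block_vecs_outside[OF V, of "m + 1"] by auto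
  have e: "b < e" "V e = zero_block"
    using LeastI[of "\<lambda>e. b < e \<and> V e = zero_block", OF ex] unfolding e_def by auto
  have em: "e \<le> m + 1" unfolding e_def using ex by (rule Least_le)
  have run: "V j \<noteq> zero_block" if "b \<le> j" "j < e" for j
    using that b not_less_Least[of j "\<lambda>e. b < e \<and> V e = zero_block"] unfolding e_def
    by (cases "j = b") auto
  define d where "d = e - 1"
  have d: "e = Suc d" "b \<le> d" "d \<le> m" using e em by (auto simp: d_def)
  define V' where "V' j = (if b \<le> j \<and> j \<le> d then V j else zero_block)" for j
  have "V' \<in> run_vecs b d n"
    using block_vecs_block[OF V] run d by (auto simp: run_vecs_def PiE_dflt_def V'_def)
  moreover have "solves_row {1..m} n f V' i r" if "(i, r) \<in> R" for i r
  proof (cases "b \<le> i \<and> i \<le> e")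
    case True
    have "V' j = V j" if "j = i \<or> Suc j = i" for j
    proof (cases "b \<le> j \<and> j \<le> d")
      case False
      then have "j < b \<or> j = e" using True that d by auto
      then show ?thesis using below[of j] e d(1) by (auto simp: V'_def)
    qed (simp add: V'_def)
    then show ?thesis using sol that solves_row_cong[of i V' V] by blast
  next
    case False
    then show ?thesis using d by (intro solves_row_zero) (auto simp: V'_def)
  qed
  moreover have "(b, d) \<in> proper_runs m"
    using bm d run[of j0] j0 by (auto simp: proper_runs_def)
  ultimately show ?thesis by blast
qed

text \<open>
  A run from \<open>b\<close> to \<open>d\<close> meets the \<open>d - b + 2\<close> block rows \<open>b, \<dots>, d + 1\<close>; the first and the last block row of
  the matrix have only half of their \<open>2 h\<close> rows.
\<close>
lemma card_hat_rows_run: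
  assumes bd: "1 \<le> b" "b \<le> d" "d \<le> m"
  shows "card {(i, r) \<in> hat_rows (2 * h) m. b \<le> i \<and> i \<le> Suc d} + h * (of_bool (b = 1) + of_bool (d = m))
    = 2 * h * (Suc (Suc d) - b)"
proof -
  define rs where "rs i = (if i = 1 then {h..<2 * h} else if i = m + 1 then {..<h} else {..<2 * h})" for i
  have "{(i, r) \<in> hat_rows (2 * h) m. b \<le> i \<and> i \<le> Suc d} = (SIGMA i:{b..Suc d}. rs i)"
    using bd by (auto simp: hat_rows_def rs_def split: if_splits)
  then have "card {(i, r) \<in> hat_rows (2 * h) m. b \<le> i \<and> i \<le> Suc d} = (\<Sum>i\<in>{b..Suc d}. card (rs i))"
    by (simp add: rs_def)
  moreover have "h * (of_bool (b = 1) + of_bool (d = m))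
    = (\<Sum>i\<in>{b..Suc d}. (if i = 1 then h else 0) + (if i = m + 1 then h else 0))"
    using bd by (simp add: sum.distrib)
  moreover have "(\<Sum>i\<in>{b..Suc d}. card (rs i)) + (\<Sum>i\<in>{b..Suc d}. (if i = 1 then h else 0) + (if i = m + 1 then h else 0))
    = (\<Sum>i\<in>{b..Suc d}. 2 * h)"
    unfolding sum.distrib[symmetric] using bd by (intro sum.cong refl) (auto simp: rs_def)
  ultimately show ?thesis by simp
qed

lemma row_pos_subset:
  assumes "W \<subseteq> {1..m}" "1 \<le> i" "i \<le> m + 1" "r < n"
  shows "row_pos W n i r \<subseteq> (band \<inter> {1..m + 1} \<times> {1..m}) \<times> ({..<n} \<times> {..<n})"
  using assms by (fastforce simp: row_pos_def band_def)

lemma finite_hat_rows: "finite (hat_rows n m)"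
  by (rule finite_subset[of _ "{1..m + 1} \<times> {..<n}"]) (auto simp: hat_rows_def)

text \<open>
  The expected number of kernel vectors supported on a run is at most \<open>z\<^sup>2\<close>, \<open>z\<close> or \<open>1\<close> when the run touches none, one
  or both ends of the index range; a proper run excludes the last case.
\<close>
lemma expected_run_kernel_le:
  fixes m h :: nat
  assumes bd: "(b, d) \<in> proper_runs m"
  defines "S \<equiv> (band \<inter> {1..m + 1} \<times> {1..m}) \<times> ({..<2 * h} \<times> {..<2 * h})"
    and "z \<equiv> 1 / real CARD('a::{field,finite}) ^ h"
  shows "(\<Sum>V\<in>run_vecs b d (2 * h). pr S (\<lambda>f :: _ \<Rightarrow> 'a.
      \<forall>(i, r)\<in>hat_rows (2 * h) m. solves_row {1..m} (2 * h) f V i r))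
    \<le> z\<^sup>2 + (if b = 1 then z else 0) + (if d = m then z else 0)"
proof -
  let ?q = "real CARD('a)"
  have q: "?q \<ge> 1" by (simp add: Suc_leI)
  have z: "z > 0" using q by (simp add: z_def)
  have bd': "1 \<le> b" "b \<le> d" "d \<le> m" "b = 1 \<longrightarrow> d \<noteq> m" using bd by (auto simp: proper_runs_def)
  define c where "c = card {(i, r) \<in> hat_rows (2 * h) m. b \<le> i \<and> i \<le> Suc d}"
  define s :: nat where "s = of_bool (b = 1) + of_bool (d = m)"
  have c: "c + h * s = 2 * h * (Suc (Suc d) - b)"
    unfolding c_def s_def by (rule card_hat_rows_run[OF bd'(1-3)])
  have pr_eq: "pr S (\<lambda>f :: _ \<Rightarrow> 'a. \<forall>(i, r)\<in>hat_rows (2 * h) m. solves_row {1..m} (2 * h) f V i r) = 1 / ?q ^ c"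
    if V: "V \<in> run_vecs b d (2 * h)" for V
  proof -
    have V': "V \<in> block_vecs {1..m} (2 * h)"
      by (rule subsetD[OF run_vecs_subset V]) (use bd' in auto)
    have "pr S (\<lambda>f :: _ \<Rightarrow> 'a. \<forall>(i, r)\<in>hat_rows (2 * h) m. solves_row {1..m} (2 * h) f V i r)
      = (\<Prod>(i, r)\<in>hat_rows (2 * h) m. if active V i then 1 / ?q else 1)"
    proof (rule pr_solves_rows[OF _ finite_hat_rows _ V'])
      fix i r assume "(i, r) \<in> hat_rows (2 * h) m"
      then show "row_pos {1..m} (2 * h) i r \<subseteq> S"
        unfolding S_def by (intro row_pos_subset) (auto simp: hat_rows_def)
    qed (simp add: S_def)
    also have "\<dots> = (\<Prod>\<rho>\<in>hat_rows (2 * h) m. if \<rho> \<in> {(i, r). b \<le> i \<and> i \<le> Suc d} then 1 / ?q else 1)"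
      by (intro prod.cong refl) (auto simp: run_vecs_active_iff[OF V bd'(2)] split: if_splits)
    also have "\<dots> = (1 / ?q) ^ card (hat_rows (2 * h) m \<inter> {(i, r). b \<le> i \<and> i \<le> Suc d})"
      by (simp only: prod.inter_restrict[OF finite_hat_rows, symmetric] prod_constant)
    also have "hat_rows (2 * h) m \<inter> {(i, r). b \<le> i \<and> i \<le> Suc d} = {(i, r) \<in> hat_rows (2 * h) m. b \<le> i \<and> i \<le> Suc d}"
      by auto
    finally show ?thesis by (simp add: c_def power_one_over)
  qed
  have "(\<Sum>V\<in>run_vecs b d (2 * h). pr S (\<lambda>f :: _ \<Rightarrow> 'a.
      \<forall>(i, r)\<in>hat_rows (2 * h) m. solves_row {1..m} (2 * h) f V i r))
    = real (card (run_vecs b d (2 * h) :: (nat \<Rightarrow> nat \<Rightarrow> 'a) set)) * (1 / ?q ^ c)"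
    by (subst sum.cong[OF refl pr_eq]) simp_all
  also have "\<dots> \<le> (?q ^ (2 * h)) ^ (Suc d - b) * (1 / ?q ^ c)"
  proof (intro mult_right_mono)
    have "card (run_vecs b d (2 * h) :: (nat \<Rightarrow> nat \<Rightarrow> 'a) set) \<le> (CARD('a) ^ (2 * h)) ^ (Suc d - b)"
      unfolding card_run_vecs by (intro power_mono) auto
    then show "real (card (run_vecs b d (2 * h) :: (nat \<Rightarrow> nat \<Rightarrow> 'a) set)) \<le> (?q ^ (2 * h)) ^ (Suc d - b)"
      by (metis of_nat_le_iff of_nat_power)
  qed simp
  also have "\<dots> = ?q ^ (h * s) * z\<^sup>2"
  proof -
    have "2 * h * (Suc (Suc d) - b) = 2 * h + 2 * h * (Suc d - b)" using bd' by (simp add: Suc_diff_le)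
    then have "?q ^ (h * s) * ?q ^ c = ?q ^ (2 * h) * (?q ^ (2 * h)) ^ (Suc d - b)"
      using c by (simp only: power_mult[symmetric] power_add[symmetric] add.commute[of "h * s"])
    moreover have "?q ^ (2 * h) * z\<^sup>2 = 1" using q by (simp add: z_def power_mult power2_eq_square power_mult_distrib)
    ultimately show ?thesis using q by (simp add: field_simps)
  qed
  also have "\<dots> \<le> z\<^sup>2 + (if b = 1 then z else 0) + (if d = m then z else 0)"
  proof -
    have "?q ^ h * z\<^sup>2 = z" using q by (simp add: z_def power2_eq_square)
    then show ?thesis using bd'(4) z by (auto simp: s_def)
  qed
  finally show ?thesis .
qed

lemma pr_proper_run_kernel_le:
  fixes m h :: nat
  defines "S \<equiv> (band \<inter> {1..m + 1} \<times> {1..m}) \<times> ({..<2 * h} \<times> {..<2 * h})"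
    and "z \<equiv> 1 / real CARD('a::{field,finite}) ^ h"
  shows "pr S (\<lambda>f :: _ \<Rightarrow> 'a. \<exists>(b, d)\<in>proper_runs m. \<exists>V\<in>run_vecs b d (2 * h).
      \<forall>(i, r)\<in>hat_rows (2 * h) m. solves_row {1..m} (2 * h) f V i r)
    \<le> (real m * z)\<^sup>2 + 2 * (real m * z)"
proof -
  define sol where "sol f V \<longleftrightarrow> (\<forall>(i, r)\<in>hat_rows (2 * h) m. solves_row {1..m} (2 * h) f V i r)"
    for f and V :: "nat \<Rightarrow> nat \<Rightarrow> 'a"
  define run where "run p = (run_vecs (fst p) (snd p) (2 * h) :: (nat \<Rightarrow> nat \<Rightarrow> 'a) set)" for p
  have sub: "proper_runs m \<subseteq> {1..m} \<times> {1..m}" by (auto simp: proper_runs_def)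
  then have fin: "finite (proper_runs m)" by (rule finite_subset) simp
  have z: "z \<ge> 0" by (simp add: z_def)
  have "pr S (\<lambda>f. \<exists>(b, d)\<in>proper_runs m. \<exists>V\<in>run_vecs b d (2 * h). sol f V)
    = measure_pmf.prob (unif_fun S) (\<Union>p\<in>proper_runs m. \<Union>V\<in>run p. {f. sol f V})"
    by (rule arg_cong[where f = "measure_pmf.prob (unif_fun S)"]) (auto simp: run_def case_prod_beta)
  also have "\<dots> \<le> (\<Sum>p\<in>proper_runs m. measure_pmf.prob (unif_fun S) (\<Union>V\<in>run p. {f. sol f V}))"
    by (intro measure_pmf.finite_measure_subadditive_finite fin) auto
  also have "\<dots> \<le> (\<Sum>p\<in>proper_runs m. \<Sum>V\<in>run p. pr S (\<lambda>f. sol f V))"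
    by (intro sum_mono measure_pmf.finite_measure_subadditive_finite) (auto simp: run_def finite_run_vecs)
  also have "\<dots> \<le> (\<Sum>p\<in>proper_runs m. z\<^sup>2 + (if fst p = 1 then z else 0) + (if snd p = m then z else 0))"
    unfolding run_def sol_def S_def z_def by (intro sum_mono expected_run_kernel_le) simp
  also have "\<dots> \<le> (\<Sum>p\<in>{1..m} \<times> {1..m}. z\<^sup>2 + (if fst p = 1 then z else 0) + (if snd p = m then z else 0))"
    using z by (intro sum_mono2 sub) auto
  also have "\<dots> = (\<Sum>b\<in>{1..m}. \<Sum>d\<in>{1..m}. z\<^sup>2 + (if b = 1 then z else 0) + (if d = m then z else 0))"
    unfolding sum.cartesian_product by (rule sum.cong) auto
  also have "\<dots> \<le> (real m * z)\<^sup>2 + 2 * (real m * z)"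
    using z by (cases "m = 0") (auto simp: sum.distrib sum_distrib_left[symmetric] power2_eq_square algebra_simps)
  finally show ?thesis unfolding sol_def .
qed

lemma depends_on_solves_rows:
  assumes "\<And>i r. (i, r) \<in> R \<Longrightarrow> row_pos W n i r \<subseteq> D"
  shows "depends_on D (\<lambda>f. \<exists>V\<in>A. P V \<and> (\<forall>(i, r)\<in>R. solves_row W n f V i r))"
proof -
  have "solves_row W n f V i r = solves_row W n g V i r" if "\<forall>p\<in>D. f p = g p" "(i, r) \<in> R" for f g V i r
    using depends_on_solves_row[of W n i r V] assms[OF that(2)] that(1) unfolding depends_on_def by blast
  then show ?thesis unfolding depends_on_def by fast
qed

lemma prob_delocalized_ge:
  fixes h k :: nat
  assumes h: "h > 0"
  defines "y \<equiv> real (k + 1) / real CARD('a::{field,finite}) ^ h"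
  shows "\<P>(\<omega> in (block_space (2 * h) :: (nat \<times> nat \<Rightarrow> 'a mat) measure). delocalized_kernel (2 * h) k \<omega>)
    \<ge> 1 - (y\<^sup>2 + 2 * y)"
proof -
  let ?n = "2 * h" and ?m = "k + 1"
  let ?B = "block_space ?n :: (nat \<times> nat \<Rightarrow> 'a mat) measure"
  let ?J = "band \<inter> {1..?m + 1} \<times> {1..?m}"
  let ?Q = "\<lambda>f :: _ \<Rightarrow> 'a. \<exists>(b, d)\<in>proper_runs ?m. \<exists>V\<in>run_vecs b d ?n.
      \<forall>(i, r)\<in>hat_rows ?n ?m. solves_row {1..?m} ?n f V i r"
  interpret B: prob_space ?B by (rule prob_space_block_space)
  have fin: "finite ?J" by (rule finite_Int) simp
  have sub: "row_pos {1..?m} ?n i r \<subseteq> ?J \<times> ({..<?n} \<times> {..<?n})" if "(i, r) \<in> hat_rows ?n ?m" for i r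
    by (rule row_pos_subset) (use that in \<open>auto simp: hat_rows_def\<close>)
  have Q_eq: "?Q = (\<lambda>f. \<exists>V\<in>(\<Union>(b, d)\<in>proper_runs ?m. run_vecs b d ?n). True \<and>
      (\<forall>(i, r)\<in>hat_rows ?n ?m. solves_row {1..?m} ?n f V i r))"
    by (intro ext) blast
  have dep: "depends_on (?J \<times> ({..<?n} \<times> {..<?n})) ?Q"
    unfolding Q_eq by (rule depends_on_solves_rows[OF sub])
  note event = block_space_event[OF fin Int_lower1 dep]
  have "{\<omega> \<in> space ?B. \<not> delocalized_kernel ?n k \<omega>} \<subseteq> {\<omega> \<in> space ?B. ?Q (entries \<omega>)}"
  proof safe
    fix \<omega> :: "nat \<times> nat \<Rightarrow> 'a mat" assume "\<not> delocalized_kernel ?n k \<omega>"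
    then obtain v where "v \<in> mat_kernel (C_hat ?n \<omega> k)" and v0: "v \<noteq> 0\<^sub>v (?m * ?n)"
      and supp: "supp ?n ?m v \<noteq> {1..?m}"
      unfolding delocalized_kernel_def by blast
    then have v: "v \<in> carrier_vec (?m * ?n)" "C_hat ?n \<omega> k *\<^sub>v v = 0\<^sub>v (?m * ?n)"
      by (auto simp: mat_kernel_def C_hat_def)
    obtain j1 where j1: "to_blocks ?n ?m v j1 \<noteq> zero_block" using to_blocks_eq_0[OF v(1)] v0 by blast
    obtain j0 where j0: "1 \<le> j0" "j0 \<le> ?m" "to_blocks ?n ?m v j0 = zero_block"
      using supp unfolding supp_eq by (auto simp del: One_nat_def)
    show "?Q (entries \<omega>)"
      by (rule exists_proper_run[OF to_blocks_in_block_vecs j1 j0])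
        (use v(2) C_hat_kernel_iff[OF v(1)] h in simp)
  qed
  then have "B.prob {\<omega> \<in> space ?B. \<not> delocalized_kernel ?n k \<omega>} \<le> B.prob {\<omega> \<in> space ?B. ?Q (entries \<omega>)}"
    by (rule B.finite_measure_mono[OF _ event(1)])
  also have "\<dots> \<le> y\<^sup>2 + 2 * y"
    unfolding event(2) using pr_proper_run_kernel_le[where 'a = 'a, of ?m h] by (simp add: y_def)
  finally show ?thesis
    using B.prob_neg[OF sets_delocalized_kernel[of ?n k, where ?'a = 'a]] by simp
qed

section \<open>Localization\<close>

lemma solves_row_mono_window:
  assumes V: "V \<in> block_vecs W n" and W: "W \<subseteq> W'" "finite W'"
  shows "solves_row W' n f V i r = solves_row W n f V i r"
proof -
  have zero: "(\<Sum>c<n. g c * V j c) = 0" if "j \<notin> W" for j g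
    using block_vecs_outside[OF V that] by simp
  have "lin (row_pos W' n i r) (\<lambda>p. V (snd (fst p)) (snd (snd p))) f
      = lin (row_pos W n i r) (\<lambda>p. V (snd (fst p)) (snd (snd p))) f"
    unfolding lin_row_pos using W by (intro sum.mono_neutral_right) (auto intro: zero)
  then show ?thesis by (simp add: solves_row_def)
qed

lemma window_kernel_imp_kernel:
  assumes V: "V \<in> block_vecs {a<..a + K} n" and W: "a + K \<le> k + 1" and n: "n > 0"
    and sol: "\<forall>(i, r)\<in>{a<..Suc (a + K)} \<times> {..<n}. solves_row {a<..a + K} n (entries \<omega>) V i r"
  shows "C_hat n \<omega> k *\<^sub>v of_blocks n (k + 1) V = 0\<^sub>v ((k + 1) * n)"
    and "to_blocks n (k + 1) (of_blocks n (k + 1) V) = V"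
proof -
  have sub: "{a<..a + K} \<subseteq> {1..k + 1}" using W by auto
  have "V \<in> block_vecs {1..k + 1} n"
    unfolding block_vecs_def PiE_dflt_def
    using sub block_vecs_block[OF V] block_vecs_outside[OF V] by blast
  then show eq: "to_blocks n (k + 1) (of_blocks n (k + 1) V) = V" by (rule to_blocks_of_blocks)
  have "solves_row {1..k + 1} n (entries \<omega>) V i r" if ir: "(i, r) \<in> hat_rows n (k + 1)" for i r
  proof (cases "i \<in> {a<..Suc (a + K)}")
    case True
    then have "solves_row {a<..a + K} n (entries \<omega>) V i r" using sol ir by (auto simp: hat_rows_def)
    then show ?thesis by (simp only: solves_row_mono_window[OF V sub finite_atLeastAtMost])
  next
    case False
    then show ?thesis using block_vecs_outside[OF V] by (intro solves_row_zero) auto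
  qed
  then show "C_hat n \<omega> k *\<^sub>v of_blocks n (k + 1) V = 0\<^sub>v ((k + 1) * n)"
    by (subst C_hat_kernel_iff[OF of_blocks_carrier n]) (auto simp only: eq)
qed

text \<open>
  Two consecutive windows may share a block row, but never a block column, so they use different blocks of the random matrix and
  behave independently.
\<close>
lemma prob_localized_ge:
  fixes n k L K :: nat
  assumes n: "n > 0" and K: "K \<ge> 1" "6 * (real CARD('a))\<^sup>2 * (real K)\<^sup>2 * (1 / real CARD('a) ^ n) \<le> 1"
    and KL: "K \<le> (k + 1) div L"
  shows "\<P>(\<omega> in (block_space n :: (nat \<times> nat \<Rightarrow> 'a::{field,finite} mat) measure). localized_kernel n k L \<omega>)
    \<ge> ((real K)\<^sup>2 * (1 / real CARD('a) ^ n) / (8 * real CARD('a))) ^ L"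
proof -
  let ?m = "k + 1"
  let ?B = "block_space n :: (nat \<times> nat \<Rightarrow> 'a mat) measure"
  let ?J = "band \<inter> {1..?m + 1} \<times> {1..?m}"
  let ?S = "?J \<times> ({..<n} \<times> {..<n})"
  let ?p = "(real K)\<^sup>2 * (1 / real CARD('a) ^ n) / (8 * real CARD('a))"
  define l where "l = ?m div L"
  define a where "a i = (i - 1) * l" for i
  define W where "W i = {a i<..a i + K}" for i
  define R where "R i = {a i<..Suc (a i + K)} \<times> {..<n}" for i
  define D where "D i = (\<Union>(i', r)\<in>R i. row_pos (W i) n i' r)" for i
  define Q where "Q i f \<longleftrightarrow> (\<exists>V\<in>block_vecs (W i) n. V \<noteq> (\<lambda>_. zero_block) \<and>
      (\<forall>(i', r)\<in>R i. solves_row (W i) n f V i' r))" for i and f :: "_ \<Rightarrow> 'a"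
  interpret B: prob_space ?B by (rule prob_space_block_space)
  have a_end: "a i + K \<le> i * l" if "1 \<le> i" for i
  proof -
    have "i * l = a i + l" using that by (cases i) (auto simp: a_def)
    then show ?thesis using KL by (simp add: l_def)
  qed
  have a_m: "a i + K \<le> ?m" if "i \<in> {1..L}" for i
  proof -
    have "i * l \<le> L * l" using that by (intro mult_right_mono) auto
    also have "\<dots> \<le> ?m" unfolding l_def by (rule times_div_less_eq_dividend)
    finally show ?thesis using a_end[of i] that by simp
  qed
  have pos: "row_pos (W i) n i' r \<subseteq> ?S" if "i \<in> {1..L}" "(i', r) \<in> R i" for i i' r
    using that a_m[OF that(1)] by (intro row_pos_subset) (auto simp: W_def R_def)
  have D: "D i \<subseteq> ?S" if "i \<in> {1..L}" for i unfolding D_def using pos[OF that] by blast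
  have W_disj: "W i \<inter> W j = {}" if "1 \<le> i" "i < j" for i j
  proof -
    have "i * l \<le> a j" unfolding a_def using that by (intro mult_right_mono) auto
    then show ?thesis using a_end[OF that(1)] by (auto simp: W_def)
  qed
  have D_disj: "disjoint_family_on D {1..L}"
    unfolding disjoint_family_on_def
  proof (intro ballI impI)
    fix i j assume ij: "i \<in> {1..L}" "j \<in> {1..L}" "i \<noteq> j"
    then have "W i \<inter> W j = {}" using W_disj[of i j] W_disj[of j i] by (cases "i < j") auto
    then show "D i \<inter> D j = {}" unfolding D_def row_pos_def by fastforce
  qed
  have depQ: "depends_on (D i) (Q i)" for i
    unfolding Q_def by (rule depends_on_solves_rows) (auto simp: D_def)
  have fin: "finite ?J" by (rule finite_Int) simp
  have finS: "finite ?S" by (intro finite_cartesian_product fin) auto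
  have dep: "depends_on ?S (\<lambda>f. \<forall>i\<in>{1..L}. Q i f)"
    using depQ D unfolding depends_on_def by (meson subsetD)
  note event = block_space_event[OF fin Int_lower1 dep]
  have p0: "?p \<ge> 0" by simp
  have "?p ^ L = (\<Prod>i\<in>{1..L}. ?p)" by simp
  also have "\<dots> \<le> (\<Prod>i\<in>{1..L}. pr ?S (Q i))"
  proof (intro prod_mono conjI p0)
    fix i assume i: "i \<in> {1..L}"
    show "?p \<le> pr ?S (Q i)"
      unfolding Q_def W_def R_def
      by (rule pr_window_kernel_ge[OF finS _ K]) (use pos[OF i] in \<open>auto simp: R_def W_def\<close>)
  qed
  also have "\<dots> = pr ?S (\<lambda>f. \<forall>i\<in>{1..L}. Q i f)"
    using D D_disj depQ by (intro pr_independent[symmetric] finS) auto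
  also have "\<dots> = B.prob {\<omega> \<in> space ?B. \<forall>i\<in>{1..L}. Q i (entries \<omega>)}"
    by (rule event(2)[symmetric])
  also have "\<dots> \<le> B.prob {\<omega> \<in> space ?B. localized_kernel n k L \<omega>}"
  proof (rule B.finite_measure_mono[OF _ sets_localized_kernel], safe)
    fix \<omega> :: "nat \<times> nat \<Rightarrow> 'a mat" assume Q: "\<forall>i\<in>{1..L}. Q i (entries \<omega>)"
    show "localized_kernel n k L \<omega>"
      unfolding localized_kernel_def
    proof
      fix i assume i: "i \<in> {1..L}"
      then obtain V where V: "V \<in> block_vecs (W i) n" "V \<noteq> (\<lambda>_. zero_block)"
        "\<forall>(i', r)\<in>R i. solves_row (W i) n (entries \<omega>) V i' r"
        using Q unfolding Q_def by blast
      let ?v = "of_blocks n ?m V"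
      note ker = window_kernel_imp_kernel[OF V(1)[unfolded W_def] a_m[OF i] n V(3)[unfolded W_def R_def]]
      have supp: "supp n ?m ?v = {j \<in> {1..?m}. V j \<noteq> zero_block}" unfolding supp_eq ker(2) ..
      obtain j where j: "V j \<noteq> zero_block" using V(2) by blast
      have in_W: "j \<in> W i" if "V j \<noteq> zero_block" for j using that block_vecs_outside[OF V(1)] by blast
      have "W i \<subseteq> {1..?m}" using a_m[OF i] by (auto simp: W_def)
      then have "supp n ?m ?v \<noteq> {}" unfolding supp using j in_W by blast
      moreover have "W i \<subseteq> {(i - 1) * (?m div L) + 1..i * (?m div L)}"
        using a_end[of i] i by (auto simp: W_def a_def l_def)
      then have "supp n ?m ?v \<subseteq> {(i - 1) * (?m div L) + 1..i * (?m div L)}" unfolding supp using in_W by blast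
      ultimately have "?v \<in> V_set n k L i" by (simp add: V_set_def del: mult_Suc)
      then show "\<exists>v\<in>V_set n k L i. C_hat n \<omega> k *\<^sub>v v = 0\<^sub>v (?m * n)" using ker(1) by blast
    qed
  qed
  finally show ?thesis .
qed

lemma eventually_even_at_top:
  "eventually P even_at_top \<longleftrightarrow> (\<exists>N. \<forall>n\<ge>N. even n \<longrightarrow> P n)"
  unfolding even_at_top_def eventually_inf_principal eventually_at_top_linorder by simp

lemma eventually_even_at_topI: "(\<And>n. n \<ge> N \<Longrightarrow> even n \<Longrightarrow> P n) \<Longrightarrow> eventually P even_at_top"
  unfolding eventually_even_at_top by blast

lemma two_le_CARD: "2 \<le> CARD('a::{field,finite})"
proof -
  have "card {0, 1 :: 'a} \<le> CARD('a)" by (intro card_mono) auto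
  then show ?thesis by simp
qed

lemma t_seq_even: "q > 1 \<Longrightarrow> t_seq q k (2 * h) = real (k (2 * h)) / (real q ^ h * (real q - 1))"
  by (simp add: t_seq_def powr_minus powr_realpow field_simps)

lemma delocalized_limit:
  fixes k :: "nat \<Rightarrow> nat"
  assumes k: "\<And>n. even n \<Longrightarrow> n > 0 \<Longrightarrow> k n > 0"
    and t: "(t_seq CARD('a::{field,finite}) k \<longlongrightarrow> 0) even_at_top"
  shows "((\<lambda>n. \<P>(\<omega> in (block_space n :: (nat \<times> nat \<Rightarrow> 'a mat) measure).
      delocalized_kernel n (k n) \<omega>)) \<longlongrightarrow> 1) even_at_top"
proof (rule tendsto_sandwich)
  let ?q = "real CARD('a)" and ?t = "t_seq CARD('a) k"
  let ?y = "\<lambda>n. 2 * (?q - 1) * ?t n"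
  have q: "?q \<ge> 2" using two_le_CARD[where 'a = 'a] by simp
  show "\<forall>\<^sub>F n in even_at_top. 1 - ((?y n)\<^sup>2 + 2 * ?y n)
      \<le> \<P>(\<omega> in (block_space n :: (nat \<times> nat \<Rightarrow> 'a mat) measure). delocalized_kernel n (k n) \<omega>)"
  proof (rule eventually_even_at_topI[of 1])
    fix n :: nat assume n: "n \<ge> 1" "even n"
    then obtain h where h: "n = 2 * h" "h > 0" by (auto elim!: evenE)
    let ?z = "real (k n + 1) / ?q ^ h"
    have "real (k n + 1) \<le> 2 * real (k n)" using k[of n] n by simp
    then have "?z \<le> 2 * real (k n) / ?q ^ h" using q by (intro divide_right_mono) auto
    also have "\<dots> = ?y n" unfolding h using q by (subst t_seq_even) (auto simp: field_simps)
    finally have le: "?z \<le> ?y n" .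
    moreover have "0 \<le> ?z" by simp
    ultimately have "?z\<^sup>2 + 2 * ?z \<le> (?y n)\<^sup>2 + 2 * ?y n" by (intro add_mono power_mono mult_left_mono) auto
    then show "1 - ((?y n)\<^sup>2 + 2 * ?y n)
      \<le> \<P>(\<omega> in (block_space n :: (nat \<times> nat \<Rightarrow> 'a mat) measure). delocalized_kernel n (k n) \<omega>)"
      using prob_delocalized_ge[OF h(2), of "k n", where ?'a = 'a] unfolding h(1) by linarith
  qed
  have "((\<lambda>n. 1 - ((?y n)\<^sup>2 + 2 * ?y n)) \<longlongrightarrow> 1 - ((2 * (?q - 1) * 0)\<^sup>2 + 2 * (2 * (?q - 1) * 0))) even_at_top"
    by (intro tendsto_intros t)
  then show "((\<lambda>n. 1 - ((?y n)\<^sup>2 + 2 * ?y n)) \<longlongrightarrow> 1) even_at_top" by simp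
  show "\<forall>\<^sub>F n in even_at_top. \<P>(\<omega> in (block_space n :: (nat \<times> nat \<Rightarrow> 'a mat) measure).
      delocalized_kernel n (k n) \<omega>) \<le> 1"
    by (intro always_eventually allI prob_space.prob_le_1 prob_space_block_space)
qed simp

text \<open>
  Here \<open>K\<close> is the integer part of \<open>q\<^sup>h y / (3 q)\<close> with \<open>y = \<epsilon> / L\<close>. The factor \<open>1 / (3 q)\<close> makes
  \<open>6 q\<^sup>2 K\<^sup>2 x \<le> 2/3\<close> and keeps \<open>K L\<close> below \<open>k\<^sub>n\<close>. Rounding down loses at most half of the value once the
  value is at least \<open>2\<close>, and \<open>(y / (6 q))\<^sup>2 / (8 q)\<close> gives the constant \<open>1 / (288 q\<^sup>3)\<close>.
\<close>
lemma prob_localized_ge_of_t_seq: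
  fixes k :: "nat \<Rightarrow> nat" and \<epsilon> :: real and L h :: nat
  assumes h: "h > 0" and L: "L > 0" "\<epsilon> \<le> real L" and eps: "\<epsilon> > 0"
    and large: "2 \<le> \<epsilon> / real L * real CARD('a) ^ h / (3 * real CARD('a))"
    and t: "\<epsilon> / 2 < t_seq CARD('a::{field,finite}) k (2 * h)"
  shows "(1 / (288 * real CARD('a) ^ 3) * (\<epsilon> / real L)\<^sup>2) ^ L
    \<le> \<P>(\<omega> in (block_space (2 * h) :: (nat \<times> nat \<Rightarrow> 'a mat) measure).
        localized_kernel (2 * h) (k (2 * h)) L \<omega>)"
proof -
  let ?q = "real CARD('a)"
  define Z where "Z = ?q ^ h"
  define y where "y = \<epsilon> / real L"
  define w where "w = y * Z / (3 * ?q)"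
  define K where "K = nat \<lfloor>w\<rfloor>"
  have q: "?q \<ge> 2" using two_le_CARD[where 'a = 'a] by simp
  have Z: "Z > 0" using q by (simp add: Z_def)
  have x: "1 / ?q ^ (2 * h) = 1 / Z\<^sup>2" by (simp add: Z_def power_mult power_commutes power2_eq_square power_add mult_2)
  have y: "0 < y" "y \<le> 1" using eps L by (auto simp: y_def)
  have w: "w \<ge> 2" using large by (simp add: w_def y_def Z_def)
  have K: "real K \<le> w" "w / 2 \<le> real K" "K \<ge> 1"
    using w by (auto simp: K_def) linarith+
  have K2: "6 * ?q\<^sup>2 * (real K)\<^sup>2 * (1 / ?q ^ (2 * h)) \<le> 1"
  proof -
    have "(real K)\<^sup>2 \<le> w\<^sup>2" using K by (intro power_mono) auto
    then have "6 * ?q\<^sup>2 * (real K)\<^sup>2 * (1 / Z\<^sup>2) \<le> 6 * ?q\<^sup>2 * w\<^sup>2 * (1 / Z\<^sup>2)"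
      by (intro mult_right_mono mult_left_mono) auto
    also have "\<dots> = 2 / 3 * y\<^sup>2" using q Z by (simp add: w_def field_simps power2_eq_square)
    also have "\<dots> \<le> 2 / 3 * 1" using y by (intro mult_left_mono) (auto simp: power_le_one)
    finally show ?thesis unfolding x by simp
  qed
  have "K \<le> (k (2 * h) + 1) div L"
  proof -
    have "real K * real L \<le> w * real L" using K L by (intro mult_right_mono) auto
    also have "\<dots> = \<epsilon> * Z / (3 * ?q)" using L by (simp add: w_def y_def)
    also have "\<dots> \<le> \<epsilon> * Z / 2" using eps Z q by (intro divide_left_mono) auto
    also have "\<dots> \<le> \<epsilon> / 2 * (Z * (?q - 1))" using eps Z q by (simp add: mult_le_cancel_left1)
    also have "\<dots> < real (k (2 * h))"
    proof -
      have "\<epsilon> / 2 < real (k (2 * h)) / (Z * (?q - 1))"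
        using t q by (subst (asm) t_seq_even) (auto simp: Z_def)
      then show ?thesis using Z q by (simp add: pos_less_divide_eq)
    qed
    finally have "real (K * L) < real (k (2 * h))" by simp
    then have "K * L < k (2 * h)" by (simp only: of_nat_less_iff)
    then have "K * L \<le> k (2 * h) + 1" by simp
    then show ?thesis using L by (simp add: less_eq_div_iff_mult_less_eq)
  qed
  note main = prob_localized_ge[OF _ K(3) K2 this]
  have "1 / (288 * ?q ^ 3) * y\<^sup>2 = (w / 2)\<^sup>2 * (1 / Z\<^sup>2) / (8 * ?q)"
    using q Z by (simp add: w_def field_simps power2_eq_square power3_eq_cube)
  also have "\<dots> \<le> (real K)\<^sup>2 * (1 / Z\<^sup>2) / (8 * ?q)"
    using K w q by (intro divide_right_mono mult_right_mono power_mono) auto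
  finally have "(1 / (288 * ?q ^ 3) * y\<^sup>2) ^ L \<le> ((real K)\<^sup>2 * (1 / ?q ^ (2 * h)) / (8 * ?q)) ^ L"
    unfolding x by (intro power_mono) auto
  also have "\<dots> \<le> \<P>(\<omega> in (block_space (2 * h) :: (nat \<times> nat \<Rightarrow> 'a mat) measure).
        localized_kernel (2 * h) (k (2 * h)) L \<omega>)"
    using h by (intro main) auto
  finally show ?thesis unfolding y_def .
qed

text \<open>
  Along a subsequence \<open>t\<^sub>n\<close> exceeds \<open>\<epsilon> / 2\<close>, and there the bound for a single \<open>n\<close> applies.
\<close>
lemma localized_limsup:
  fixes k :: "nat \<Rightarrow> nat" and \<epsilon> :: real and L :: nat
  assumes eps: "\<epsilon> > 0" and L: "L > 0" "\<epsilon> \<le> real L"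
    and t: "ereal \<epsilon> \<le> Limsup even_at_top (\<lambda>n. ereal (t_seq CARD('a::{field,finite}) k n))"
  shows "ereal ((1 / (288 * real CARD('a) ^ 3) * (\<epsilon> / real L)\<^sup>2) ^ L)
    \<le> Limsup even_at_top (\<lambda>n. ereal \<P>(\<omega> in (block_space n :: (nat \<times> nat \<Rightarrow> 'a mat) measure).
        localized_kernel n (k n) L \<omega>))"
    (is "ereal ?c \<le> Limsup _ (\<lambda>n. ereal (?P n))")
proof (rule ccontr)
  let ?q = "real CARD('a)"
  have q: "?q \<ge> 2" using two_le_CARD[where 'a = 'a] by simp
  assume "\<not> ?thesis"
  then have "eventually (\<lambda>n. ereal (?P n) < ereal ?c) even_at_top"
    by (intro Limsup_lessD) (simp only: not_le)
  then obtain N1 where N1: "\<And>n. n \<ge> N1 \<Longrightarrow> even n \<Longrightarrow> ?P n < ?c"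
    unfolding eventually_even_at_top by auto
  obtain N2 where N2: "6 * ?q / (\<epsilon> / real L) < 2 ^ N2"
    using real_arch_pow[of 2] by auto
  have large: "2 \<le> \<epsilon> / real L * ?q ^ h / (3 * ?q)" if "h \<ge> N2" for h
  proof -
    have "(2 :: real) ^ N2 \<le> 2 ^ h" using that by (intro power_increasing) auto
    also have "\<dots> \<le> ?q ^ h" using q by (intro power_mono) auto
    finally have "6 * ?q / (\<epsilon> / real L) < ?q ^ h" using N2 by linarith
    then have "6 * ?q < ?q ^ h * (\<epsilon> / real L)" using eps L by (simp only: pos_divide_less_eq divide_pos_pos of_nat_0_less_iff)
    then have "6 * ?q \<le> \<epsilon> / real L * ?q ^ h" by (simp add: mult.commute)
    then show ?thesis using q by (subst pos_le_divide_eq) auto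
  qed
  have "\<not> eventually (\<lambda>n. ereal (t_seq CARD('a) k n) \<le> ereal (\<epsilon> / 2)) even_at_top"
  proof
    assume "eventually (\<lambda>n. ereal (t_seq CARD('a) k n) \<le> ereal (\<epsilon> / 2)) even_at_top"
    then have "Limsup even_at_top (\<lambda>n. ereal (t_seq CARD('a) k n)) \<le> ereal (\<epsilon> / 2)" by (rule Limsup_bounded)
    with t have "ereal \<epsilon> \<le> ereal (\<epsilon> / 2)" by (rule order_trans)
    then show False using eps by simp
  qed
  then obtain n where n: "n \<ge> N1 + 2 * N2 + 1" "even n" "\<epsilon> / 2 < t_seq CARD('a) k n"
    unfolding eventually_even_at_top by (auto simp: not_le) 
  then obtain h where h: "n = 2 * h" by (auto elim: evenE)
  have "?c \<le> ?P n"
    using n unfolding h by (intro prob_localized_ge_of_t_seq L eps large) auto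
  then show False using N1[of n] n by simp
qed

theorem theorem10:
  shows "(\<forall>k :: nat \<Rightarrow> nat.
      (\<forall>n. even n \<and> n > 0 \<longrightarrow> k n > 0) \<longrightarrow>
      (t_seq CARD('a::{field,finite}) k \<longlongrightarrow> 0) even_at_top \<longrightarrow>
      ((\<lambda>n. \<P>(\<omega> in (block_space n :: (nat \<times> nat \<Rightarrow> 'a mat) measure).
              delocalized_kernel n (k n) \<omega>)) \<longlongrightarrow> 1) even_at_top)
    \<and>
    (\<exists>C :: real. C > 0 \<and>
      (\<forall>(k :: nat \<Rightarrow> nat) (\<epsilon> :: real).
        (\<forall>n. even n \<and> n > 0 \<longrightarrow> k n > 0) \<longrightarrow>
        \<epsilon> > 0 \<longrightarrow>
        Limsup even_at_top (\<lambda>n. ereal (t_seq CARD('a) k n)) \<ge> ereal \<epsilon> \<longrightarrow>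
        (\<forall>L :: nat. L > 0 \<and> real L \<ge> \<epsilon> \<longrightarrow>
          Limsup even_at_top (\<lambda>n. ereal \<P>(\<omega> in (block_space n :: (nat \<times> nat \<Rightarrow> 'a mat) measure).
              localized_kernel n (k n) L \<omega>))
            \<ge> ereal ((C * (\<epsilon> / real L)\<^sup>2) ^ L))))"
proof (intro conjI allI impI exI[of _ "1 / (288 * real CARD('a) ^ 3)"])
  fix k :: "nat \<Rightarrow> nat"
  assume "\<forall>n. even n \<and> n > 0 \<longrightarrow> k n > 0" "(t_seq CARD('a) k \<longlongrightarrow> 0) even_at_top"
  then show "((\<lambda>n. \<P>(\<omega> in (block_space n :: (nat \<times> nat \<Rightarrow> 'a mat) measure).
      delocalized_kernel n (k n) \<omega>)) \<longlongrightarrow> 1) even_at_top"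
    by (intro delocalized_limit) auto
next
  fix k :: "nat \<Rightarrow> nat" and \<epsilon> :: real and L :: nat
  assume "\<epsilon> > 0" "ereal \<epsilon> \<le> Limsup even_at_top (\<lambda>n. ereal (t_seq CARD('a) k n))" "L > 0 \<and> \<epsilon> \<le> real L"
  then show "ereal ((1 / (288 * real CARD('a) ^ 3) * (\<epsilon> / real L)\<^sup>2) ^ L)
    \<le> Limsup even_at_top (\<lambda>n. ereal \<P>(\<omega> in (block_space n :: (nat \<times> nat \<Rightarrow> 'a mat) measure).
        localized_kernel n (k n) L \<omega>))"
    by (intro localized_limsup) auto
qed simp

end
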